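(* Let $\mathbb F\in\{\mathbb R,\mathbb C\}$, let $K,N,R$ be positive integers, $p\geq0$ and $q\ge1$ integers. Assume that the mixing matrix $\mathbf M\in\mathbb F^{K\times R}$ has full column rank and that $$R\leq N-(p+q+1).$$ Then $\mathbf M$ and $R$ generic sources of the form $$s(n)=\frac{a_0+a_1n+\dots+a_pn^p}{b_0+b_1n+\dots+b_qn^q},\qquad n=1,\dots,N,$$ can be uniquely recovered from the observed data $\mathbf X=\mathbf M\mathbf S^T$, where $\mathbf S\in\mathbb F^{N\times R}$ is the matrix whose $r$th column is $[s_r(1)\ \dots\ s_r(N)]^T$, $s_r$ being the $r$th source.
   Context: A $K\times R$ matrix has full column rank if its rank is $R$. Each source is determined by its parameter vector $\boldsymbol\zeta=[a_0\ \dots\ a_p\ b_0\ \dots\ b_q]^T\in\mathbb F^l$ with $l=p+q+2$, where the denominator $b_0+b_1n+\dots+b_qn^q$ is required to be nonzero for $n=1,\dots,N$. "$R$ generic sources" means that the assertion holds for all parameter vectors $(\boldsymbol\zeta_1,\dots,\boldsymbol\zeta_R)\in\mathbb F^{Rl}$ outside a set of Lebesgue measure zero, where $\boldsymbol\zeta_r$ is the parameter vector of the $r$th source. "Uniquely recovered" means that the decomposition $\mathbf X=\sum_{r=1}^R\mathbf m_r\mathbf s_r^T$ ($\mathbf m_r$, $\mathbf s_r$ the $r$th columns of $\mathbf M$, $\mathbf S$) is unique up to permutation of its rank-1 terms: whenever $\mathbf X=\overline{\mathbf M}\,\overline{\mathbf S}^T$ with $\overline{\mathbf M}\in\mathbb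 F^{K\times R}$ and $\overline{\mathbf S}\in\mathbb F^{N\times R}$ such that every column of $\overline{\mathbf S}$ is a vector $[s(1)\ \dots\ s(N)]^T$ with $s(n)=\frac{a_0+a_1n+\dots+a_pn^p}{b_0+b_1n+\dots+b_qn^q}$ for $n=1,\dots,N$ (same $p,q$, arbitrary admissible parameters in $\mathbb F$, i.e. with denominator nonzero for $n=1,\dots,N$), there is a permutation $\sigma$ of $\{1,\dots,R\}$ with $\overline{\mathbf m}_r\overline{\mathbf s}_r^T=\mathbf m_{\sigma(r)}\mathbf s_{\sigma(r)}^T$ for all $r$. *)

theory Defs
  imports
    "HOL-Analysis.Analysis"
    "HOL-Combinatorics.Permutations"
    "Jordan_Normal_Form.DL_Rank"
begin

text \<open>Vectors and matrices are those of the matrix library with explicit carriers, not the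
  Cartesian products indexed by finite types.\<close>

unbundle no vec_syntax
hide_const (open) Finite_Cartesian_Product.mat Finite_Cartesian_Product.vec
hide_const (open) Finite_Cartesian_Product.row Finite_Cartesian_Product.column
hide_type (open) Finite_Cartesian_Product.vec

text \<open>A parameter vector \<open>\<zeta> = [a\<^sub>0 \<dots> a\<^sub>p b\<^sub>0 \<dots> b\<^sub>q]\<^sup>T\<close> is a function on \<open>{..<p + q + 2}\<close> with
  \<open>a\<^sub>i = \<zeta> i\<close> and \<open>b\<^sub>j = \<zeta> (p + 1 + j)\<close>; its values elsewhere are irrelevant.\<close>

definition numerator :: "nat \<Rightarrow> (nat \<Rightarrow> 'a::field) \<Rightarrow> nat \<Rightarrow> 'a" where
  "numerator p \<zeta> n = (\<Sum>i\<le>p. \<zeta> i * of_nat n ^ i)"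

definition denominator :: "nat \<Rightarrow> nat \<Rightarrow> (nat \<Rightarrow> 'a::field) \<Rightarrow> nat \<Rightarrow> 'a" where
  "denominator p q \<zeta> n = (\<Sum>j\<le>q. \<zeta> (p + 1 + j) * of_nat n ^ j)"

definition admissible :: "nat \<Rightarrow> nat \<Rightarrow> nat \<Rightarrow> (nat \<Rightarrow> 'a::field) \<Rightarrow> bool" where
  "admissible p q N \<zeta> \<longleftrightarrow> (\<forall>n\<in>{1..N}. denominator p q \<zeta> n \<noteq> 0)"

text \<open>Indices of matrix library vectors start at 0, so the sample \<open>s(n)\<close> is entry \<open>n - 1\<close>.\<close>

definition source_vec :: "nat \<Rightarrow> nat \<Rightarrow> nat \<Rightarrow> (nat \<Rightarrow> 'a::field) \<Rightarrow> 'a vec" where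
  "source_vec p q N \<zeta> = vec N (\<lambda>i. numerator p \<zeta> (i + 1) / denominator p q \<zeta> (i + 1))"

text \<open>The parameters of all \<open>R\<close> sources form one point of \<open>F\<^bsup>R(p+q+2)\<^esup>\<close>, where \<open>\<zeta> (r, i)\<close> is
  entry \<open>i\<close> of the parameter vector of source \<open>r\<close>. A property holds almost everywhere for the
  product of the Borel-Lebesgue measures iff its exceptional set has Lebesgue measure zero.\<close>

definition param_measure :: "nat \<Rightarrow> nat \<Rightarrow> nat \<Rightarrow> (nat \<times> nat \<Rightarrow> 'a::euclidean_space) measure" where
  "param_measure p q R = (\<Pi>\<^sub>M x\<in>{..<R} \<times> {..<p + q + 2}. lborel)"

definition source_mat :: "nat \<Rightarrow> nat \<Rightarrow> nat \<Rightarrow> nat \<Rightarrow> (nat \<times> nat \<Rightarrow> 'a::field) \<Rightarrow> 'a mat" where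
  "source_mat p q N R \<zeta> = mat_of_cols N (map (\<lambda>r. source_vec p q N (\<lambda>i. \<zeta> (r, i))) [0..<R])"

definition outer_product :: "'a::field vec \<Rightarrow> 'a vec \<Rightarrow> 'a mat" where
  "outer_product u v = mat (dim_vec u) (dim_vec v) (\<lambda>(i, j). u $ i * v $ j)"

definition uniquely_recovered ::
    "nat \<Rightarrow> nat \<Rightarrow> nat \<Rightarrow> nat \<Rightarrow> nat \<Rightarrow> 'a::field mat \<Rightarrow> 'a mat \<Rightarrow> bool" where
  "uniquely_recovered p q K N R M S \<longleftrightarrow>
    (\<forall>M' \<in> carrier_mat K R. \<forall>S' \<in> carrier_mat N R.
      (\<forall>r<R. \<exists>\<eta>. admissible p q N \<eta> \<and> col S' r = source_vec p q N \<eta>) \<longrightarrow>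
      M * transpose_mat S = M' * transpose_mat S' \<longrightarrow>
      (\<exists>\<sigma>. \<sigma> permutes {..<R} \<and>
        (\<forall>r<R. outer_product (col M' r) (col S' r) =
               outer_product (col M (\<sigma> r)) (col S (\<sigma> r)))))"

end

theory Submission
  imports Defs
begin

text \<open>Outside a null set the parameters \<open>\<zeta>\<close> satisfy no nontrivial polynomial relation over the integers,
  so every partial derivative \<open>\<partial>/\<partial>\<zeta>\<^sub>x\<close> extends to a derivation \<open>D\<close> of the whole field \<open>F\<close>. Suppose that
  \<open>\<Sum>\<^sub>r c\<^sub>r s\<^sub>r(n) = A(n) / B(n)\<close> for \<open>k \<ge> 2\<close> sources, all \<open>c\<^sub>r \<noteq> 0\<close> and \<open>n = 1, \<dots>, k + p + q + 1\<close>.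
  Applying these derivations (which also act on the \<open>c\<^sub>r\<close> and on the coefficients of \<open>A\<close> and \<open>B\<close>) shows
  that the tangent vectors at all \<open>s\<^sub>r\<close> lie in the span of the \<open>s\<^sub>r\<close> and the vectors \<open>n\<^sup>i / B(n)\<^sup>2\<close>,
  \<open>i \<le> p + q\<close>. The combination itself is a linear relation between these, so the span has dimension at
  most \<open>k + p + q\<close>. But for generic parameters the tangent vectors span the whole space, as a special
  choice of sources shows. Hence only multiples of a single \<open>s\<^sub>r\<close> in the span of the generic
  sources are again sources, and the uniqueness of the decomposition is linear algebra.\<close>

subsection \<open>Extension of derivations\<close>

text \<open>A pair \<open>(x, a)\<close> stands for the dual number \<open>x + a \<epsilon>\<close>, \<open>\<epsilon>\<^sup>2 = 0\<close>. A subring of the dual numbers that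
  is the graph of a function is the same thing as a derivation on a subring of the field.\<close>

definition dual_subring :: "('a::field_char_0 \<times> 'a) set \<Rightarrow> bool" where
  "dual_subring G \<longleftrightarrow> (1, 0) \<in> G \<and>
     (\<forall>x a y b. (x, a) \<in> G \<longrightarrow> (y, b) \<in> G \<longrightarrow>
        (x + y, a + b) \<in> G \<and> (x * y, a * y + x * b) \<in> G \<and> (- x, - a) \<in> G)"

definition derivation_graph :: "('a::field_char_0 \<times> 'a) set \<Rightarrow> bool" where
  "derivation_graph G \<longleftrightarrow> dual_subring G \<and> (\<forall>a. (0, a) \<in> G \<longrightarrow> a = 0)"

text \<open>\<open>f + \<epsilon> h\<close> is a polynomial with coefficients in \<open>G\<close>; its value at \<open>u + w \<epsilon>\<close> is
  \<open>poly f u + dual_eval u w f h \<epsilon>\<close>.\<close>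

definition coeffs_in :: "('a::field_char_0 \<times> 'a) set \<Rightarrow> 'a poly \<Rightarrow> 'a poly \<Rightarrow> bool" where
  "coeffs_in G f h \<longleftrightarrow> (\<forall>i. (coeff f i, coeff h i) \<in> G)"

definition dual_eval :: "'a::field_char_0 \<Rightarrow> 'a \<Rightarrow> 'a poly \<Rightarrow> 'a poly \<Rightarrow> 'a" where
  "dual_eval u w f h = poly h u + poly (pderiv f) u * w"

definition dual_adjoin :: "('a::field_char_0 \<times> 'a) set \<Rightarrow> 'a \<Rightarrow> 'a \<Rightarrow> ('a \<times> 'a) set" where
  "dual_adjoin G u w = {(poly f u, dual_eval u w f h) | f h. coeffs_in G f h}"

definition is_derivation :: "('a::field_char_0 \<Rightarrow> 'a) \<Rightarrow> bool" where
  "is_derivation D \<longleftrightarrow> (\<forall>x y. D (x + y) = D x + D y) \<and> (\<forall>x y. D (x * y) = D x * y + x * D y)"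

section \<open>Rings of dual numbers and the adjunction of one element\<close>

context
  fixes G :: "('a::field_char_0 \<times> 'a) set"
  assumes G: "dual_subring G"
begin

lemma dual_one: "(1, 0) \<in> G"
  and dual_add: "(x, a) \<in> G \<Longrightarrow> (y, b) \<in> G \<Longrightarrow> (x + y, a + b) \<in> G"
  and dual_mult: "(x, a) \<in> G \<Longrightarrow> (y, b) \<in> G \<Longrightarrow> (x * y, a * y + x * b) \<in> G"
  and dual_minus: "(x, a) \<in> G \<Longrightarrow> (- x, - a) \<in> G"
  using G unfolding dual_subring_def by blast+

lemma dual_zero: "(0, 0) \<in> G"
  using dual_add[OF dual_one dual_minus[OF dual_one]] by simp

lemma dual_of_nat: "(of_nat n, 0) \<in> G"
proof (induction n)
  case 0 then show ?case using dual_zero by simp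
next
  case (Suc n)
  then show ?case using dual_add[OF dual_one Suc] by simp
qed

lemma dual_sum:
  "(\<And>i. i \<in> I \<Longrightarrow> (f i, g i) \<in> G) \<Longrightarrow> (sum f I, sum g I) \<in> G"
  by (induction I rule: infinite_finite_induct) (simp_all add: dual_zero dual_add)

lemma coeffs_in_const: "(x, a) \<in> G \<Longrightarrow> coeffs_in G [:x:] [:a:]"
  unfolding coeffs_in_def by (auto simp: coeff_pCons dual_zero split: nat.splits)

lemma coeffs_in_monom: "(x, a) \<in> G \<Longrightarrow> coeffs_in G (monom x n) (monom a n)"
  unfolding coeffs_in_def by (auto simp: dual_zero)

lemma coeffs_in_add: "coeffs_in G f h \<Longrightarrow> coeffs_in G f' h' \<Longrightarrow> coeffs_in G (f + f') (h + h')"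
  unfolding coeffs_in_def by (auto simp: dual_add)

lemma coeffs_in_minus: "coeffs_in G f h \<Longrightarrow> coeffs_in G (- f) (- h)"
  unfolding coeffs_in_def by (auto simp: dual_minus)

text \<open>The dual part of a product of polynomials follows the Leibniz rule; coefficientwise it
  is a convolution of products in \<open>G\<close>.\<close>

lemma coeffs_in_mult:
  assumes "coeffs_in G f h" "coeffs_in G f' h'"
  shows "coeffs_in G (f * f') (h * f' + f * h')"
  unfolding coeffs_in_def
proof
  fix n
  have "(\<Sum>i\<le>n. coeff f i * coeff f' (n - i),
      \<Sum>i\<le>n. coeff h i * coeff f' (n - i) + coeff f i * coeff h' (n - i)) \<in> G"
    using assms unfolding coeffs_in_def by (intro dual_sum dual_mult) auto
  then show "(coeff (f * f') n, coeff (h * f' + f * h') n) \<in> G"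
    by (simp add: coeff_mult sum.distrib)
qed

text \<open>Natural numbers lie in \<open>G\<close> with dual part 0, so formal differentiation
  stays within \<open>G\<close>. This lets the derivative of a minimal relation compete with that
  relation.\<close>

lemma coeffs_in_pderiv: "coeffs_in G f h \<Longrightarrow> coeffs_in G (pderiv f) (pderiv h)"
  unfolding coeffs_in_def
proof
  fix n
  assume "\<forall>i. (coeff f i, coeff h i) \<in> G"
  then have "(of_nat (Suc n) * coeff f (Suc n), 0 * coeff f (Suc n) + of_nat (Suc n) * coeff h (Suc n)) \<in> G"
    by (intro dual_mult dual_of_nat) auto
  then show "(coeff (pderiv f) n, coeff (pderiv h) n) \<in> G"
    by (simp add: coeff_pderiv)
qed

text \<open>The adjunction is the image of the polynomials with coefficients in \<open>G\<close>
  under evaluation at \<open>u + w \<epsilon>\<close>, which respects sums and products.\<close>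

lemma dual_subring_adjoin: "dual_subring (dual_adjoin G u w)"
  unfolding dual_subring_def
proof (intro conjI allI impI)
  have "coeffs_in G [:1:] [:0:]" by (rule coeffs_in_const[OF dual_one])
  then show "(1, 0) \<in> dual_adjoin G u w"
    unfolding dual_adjoin_def dual_eval_def by (force simp: pderiv_pCons)
next
  fix x a y b
  assume "(x, a) \<in> dual_adjoin G u w" "(y, b) \<in> dual_adjoin G u w"
  then obtain f h f' h' where f: "coeffs_in G f h" "x = poly f u" "a = dual_eval u w f h"
    and f': "coeffs_in G f' h'" "y = poly f' u" "b = dual_eval u w f' h'"
    unfolding dual_adjoin_def by blast
  have "x + y = poly (f + f') u" "a + b = dual_eval u w (f + f') (h + h')"
    using f f' by (auto simp: dual_eval_def pderiv_add algebra_simps)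
  then show "(x + y, a + b) \<in> dual_adjoin G u w"
    using coeffs_in_add[OF f(1) f'(1)] unfolding dual_adjoin_def by blast
  have "x * y = poly (f * f') u" "a * y + x * b = dual_eval u w (f * f') (h * f' + f * h')"
    using f f' by (auto simp: dual_eval_def pderiv_mult algebra_simps)
  then show "(x * y, a * y + x * b) \<in> dual_adjoin G u w"
    using coeffs_in_mult[OF f(1) f'(1)] unfolding dual_adjoin_def by blast
  have "- x = poly (- f) u" "- a = dual_eval u w (- f) (- h)"
    using f by (auto simp: dual_eval_def pderiv_minus algebra_simps)
  then show "(- x, - a) \<in> dual_adjoin G u w"
    using coeffs_in_minus[OF f(1)] unfolding dual_adjoin_def by blast
qed

lemma dual_adjoin_superset: "G \<subseteq> dual_adjoin G u w"
proof clarify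
  fix x a assume "(x, a) \<in> G"
  then have "coeffs_in G [:x:] [:a:]" by (rule coeffs_in_const)
  then show "(x, a) \<in> dual_adjoin G u w"
    unfolding dual_adjoin_def dual_eval_def by (force simp: pderiv_pCons)
qed

lemma dual_adjoin_new: "(u, w) \<in> dual_adjoin G u w"
proof -
  have "coeffs_in G (monom 1 1) (monom 0 1)" by (rule coeffs_in_monom[OF dual_one])
  then have "(poly (monom 1 1) u, dual_eval u w (monom 1 1) (monom 0 1)) \<in> dual_adjoin G u w"
    unfolding dual_adjoin_def by blast
  then show ?thesis by (simp add: dual_eval_def poly_monom pderiv_monom)
qed

end

text \<open>Single-valuedness of a ring of dual numbers is decided over 0 alone, hence by the
  polynomials that vanish at \<open>u\<close>.\<close>

lemma derivation_graph_adjoin: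
  assumes "dual_subring G"
    and "\<And>f h. coeffs_in G f h \<Longrightarrow> poly f u = 0 \<Longrightarrow> dual_eval u w f h = 0"
  shows "derivation_graph (dual_adjoin G u w)"
  using dual_subring_adjoin[OF assms(1)] assms(2)
  unfolding derivation_graph_def dual_adjoin_def by force

lemma derivation_graph_unique:
  assumes "derivation_graph G" "(x, a) \<in> G" "(x, b) \<in> G"
  shows "a = b"
proof -
  have G: "dual_subring G" using assms(1) by (simp add: derivation_graph_def)
  have "(x + - x, a + - b) \<in> G"
    by (intro dual_add[OF G] dual_minus[OF G] assms)
  then show ?thesis using assms(1) unfolding derivation_graph_def by force
qed

text \<open>A new element \<open>u\<close> satisfies a polynomial relation of minimal degree, which forces the value of
  the derivation at \<open>u\<close>; without a relation the value is free.\<close>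

lemma derivation_graph_extend:
  assumes "derivation_graph G"
  obtains G' w where "derivation_graph G'" "G \<subseteq> G'" "(u, w) \<in> G'"
proof -
  have G: "dual_subring G" and inj: "\<And>a. (0, a) \<in> G \<Longrightarrow> a = 0"
    using assms by (auto simp: derivation_graph_def)
  have "\<exists>w. \<forall>f h. coeffs_in G f h \<longrightarrow> poly f u = 0 \<longrightarrow> dual_eval u w f h = 0"
  proof (cases "\<exists>f h. coeffs_in G f h \<and> f \<noteq> 0 \<and> poly f u = 0")
    case False
    \<comment> \<open>Here \<open>u\<close> is transcendental over \<open>G\<close> and every value
      would be consistent; 0 is chosen.\<close>
    have "dual_eval u 0 f h = 0" if "coeffs_in G f h" "poly f u = 0" for f h
    proof -
      have "f = 0" using that False by blast
      then have "h = 0" using that(1) inj by (auto simp: coeffs_in_def poly_eq_iff)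
      then show ?thesis using \<open>f = 0\<close> by (simp add: dual_eval_def)
    qed
    then show ?thesis by blast
  next
    case True
    define d where "d = (LEAST d. \<exists>f h. coeffs_in G f h \<and> f \<noteq> 0 \<and> poly f u = 0 \<and> degree f = d)"
    have "\<exists>d f h. coeffs_in G f h \<and> f \<noteq> 0 \<and> poly f u = 0 \<and> degree f = d" using True by blast
    from LeastI_ex[OF this] obtain f h where f: "coeffs_in G f h" "f \<noteq> 0" "poly f u = 0"
      and fd: "degree f = d" unfolding d_def by blast
    have least: "d \<le> degree g" if "coeffs_in G g k" "g \<noteq> 0" "poly g u = 0" for g k
      unfolding d_def using that by (intro Least_le) blast
    have d0: "degree f \<noteq> 0"
    proof
      assume "degree f = 0"
      then obtain c where "f = [:c:]" by (rule degree_eq_zeroE)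
      then show False using f(2,3) by simp
    qed
    \<comment> \<open>In characteristic 0 the derivative of a nonconstant polynomial is nonzero and
      of smaller degree, so by minimality of \<open>d\<close> it cannot vanish at
      \<open>u\<close>.\<close>
    have f': "poly (pderiv f) u \<noteq> 0"
    proof
      assume "poly (pderiv f) u = 0"
      moreover have "pderiv f \<noteq> 0" using d0 by (simp add: pderiv_eq_0_iff)
      ultimately have "d \<le> degree (pderiv f)"
        using coeffs_in_pderiv[OF G f(1)] least by blast
      then show False using d0 fd by (simp add: degree_pderiv)
    qed
    \<comment> \<open>The only solution of \<open>dual_eval u w f h = 0\<close>, the equation that
      the minimal relation imposes.\<close>
    define w where "w = - poly h u / poly (pderiv f) u"
    have Df: "dual_eval u w f h = 0" using f' by (simp add: dual_eval_def w_def)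
    \<comment> \<open>Every relation is reduced by pseudo-division by \<open>f\<close>. The
      induction measure places the zero polynomial below the nonzero constants.\<close>
    have "dual_eval u w g k = 0" if "coeffs_in G g k" "poly g u = 0" for g k
      using that
    proof (induction "if g = 0 then 0 else Suc (degree g)" arbitrary: g k rule: less_induct)
      case less
      show ?case
      proof (cases "g = 0")
        case True
        then have "k = 0" using less.prems(1) inj by (auto simp: coeffs_in_def poly_eq_iff)
        then show ?thesis using True by (simp add: dual_eval_def)
      next
        case False
        define e where "e = degree g - d"
        have de: "degree g = e + d" using least[OF less.prems(1) False less.prems(2)] by (simp add: e_def)
        define c where "c = coeff f d"
        define c' where "c' = coeff h d"
        define l where "l = coeff g (degree g)"
        define l' where "l' = coeff k (degree g)"
        have c: "(c, c') \<in> G" "(l, l') \<in> G" "c \<noteq> 0"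
          using f less.prems fd unfolding coeffs_in_def c_def c'_def l_def l'_def by auto
        \<comment> \<open>The factor \<open>c\<close> makes the leading terms cancel without
          division, since \<open>G\<close> is only a ring. \<open>k2\<close> is the corresponding
          dual part, by the Leibniz rule.\<close>
        define g2 where "g2 = [:c:] * g + - (monom l e * f)"
        define k2 where "k2 = ([:c':] * g + [:c:] * k) + - (monom l' e * f + monom l e * h)"
        have g2: "coeffs_in G g2 k2"
          unfolding g2_def k2_def
          by (intro coeffs_in_add[OF G] coeffs_in_mult[OF G] coeffs_in_minus[OF G] coeffs_in_const[OF G]
                coeffs_in_monom[OF G] c f less.prems)
        have g2u: "poly g2 u = 0" using less.prems f by (simp add: g2_def)
        have "degree g2 \<le> degree g"
        proof -
          have "degree (monom l e * f) \<le> e + d"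
            using fd degree_mult_le[of "monom l e" f] degree_monom_le[of l e] by linarith
          then show ?thesis unfolding g2_def using de by (intro degree_add_le) auto
        qed
        moreover have "coeff g2 (degree g) = 0"
          by (simp add: g2_def coeff_monom_mult de c_def l_def)
        ultimately have "g2 = 0 \<or> degree g2 < degree g"
          by (metis le_neq_implies_less leading_coeff_0_iff)
        then have "dual_eval u w g2 k2 = 0"
          using False by (intro less.hyps[OF _ g2 g2u]) auto
        \<comment> \<open>The remaining terms of the Leibniz rule contain \<open>poly g u\<close> or
          \<open>poly f u\<close>, which are 0.\<close>
        moreover have "dual_eval u w g2 k2 = c * dual_eval u w g k - poly (monom l e) u * dual_eval u w f h"
          using less.prems f unfolding g2_def k2_def dual_eval_def
          by (simp add: pderiv_add pderiv_diff pderiv_minus pderiv_mult pderiv_pCons pderiv_smult algebra_simps)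
        ultimately show ?thesis using Df c(3) by simp
      qed
    qed
    then show ?thesis by blast
  qed
  then obtain w where "\<And>f h. coeffs_in G f h \<Longrightarrow> poly f u = 0 \<Longrightarrow> dual_eval u w f h = 0" by blast
  then show ?thesis
    using that derivation_graph_adjoin[OF G] dual_adjoin_superset[OF G] dual_adjoin_new[OF G] by blast
qed

section \<open>Passage to a derivation of the whole field\<close>

lemma derivation_graph_Union:
  assumes "\<C> \<noteq> {}" "subset.chain {G. derivation_graph G} \<C>"
  shows "derivation_graph (\<Union>\<C>)"
proof -
  have der: "derivation_graph G" if "G \<in> \<C>" for G
    using assms(2) that unfolding subset.chain_def by blast
  have sub: "\<And>G. G \<in> \<C> \<Longrightarrow> dual_subring G" using der by (auto simp: derivation_graph_def)
  have one: "(1, 0) \<in> \<Union>\<C>" using assms(1) sub dual_one by blast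
  have common: "\<exists>G\<in>\<C>. X \<in> G \<and> Y \<in> G" if "X \<in> \<Union>\<C>" "Y \<in> \<Union>\<C>" for X Y
    using that assms(2) unfolding subset_chain_def by blast
  show ?thesis
    unfolding derivation_graph_def dual_subring_def
  proof (intro conjI allI impI one)
    fix x a y b assume "(x, a) \<in> \<Union>\<C>" "(y, b) \<in> \<Union>\<C>"
    then obtain G where G: "G \<in> \<C>" "(x, a) \<in> G" "(y, b) \<in> G" using common by blast
    show "(x + y, a + b) \<in> \<Union>\<C>" using G dual_add[OF sub] by blast
    show "(x * y, a * y + x * b) \<in> \<Union>\<C>" using G dual_mult[OF sub] by blast
    show "(- x, - a) \<in> \<Union>\<C>" using G dual_minus[OF sub] by blast
  next
    fix a assume "(0, a) \<in> \<Union>\<C>"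
    then show "a = 0" using der by (auto simp: derivation_graph_def)
  qed
qed

text \<open>By Zorn's lemma there is a maximal derivation graph above \<open>G\<close>. Any field
  element could still be adjoined to it, so it already has a value everywhere.\<close>

lemma derivation_extension:
  fixes G :: "('a::field_char_0 \<times> 'a) set"
  assumes "derivation_graph G"
  obtains D where "is_derivation D" "\<And>x a. (x, a) \<in> G \<Longrightarrow> D x = a"
proof -
  define \<A> where "\<A> = {H. derivation_graph H \<and> G \<subseteq> H}"
  have "\<exists>M\<in>\<A>. \<forall>X\<in>\<A>. M \<subseteq> X \<longrightarrow> X = M"
  proof (rule subset_Zorn_nonempty)
    show "\<A> \<noteq> {}" using assms by (auto simp: \<A>_def)
    fix \<C> assume C: "\<C> \<noteq> {}" "subset.chain \<A> \<C>"
    then have "subset.chain {G. derivation_graph G} \<C>"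
      unfolding subset.chain_def \<A>_def by blast
    then have "derivation_graph (\<Union>\<C>)" by (rule derivation_graph_Union[OF C(1)])
    moreover obtain H where "H \<in> \<C>" using C(1) by blast
    moreover from this have "G \<subseteq> H" using C(2) unfolding subset.chain_def \<A>_def by blast
    ultimately show "\<Union>\<C> \<in> \<A>" unfolding \<A>_def by blast
  qed
  then obtain M where M_in: "M \<in> \<A>" and M_max: "\<And>X. X \<in> \<A> \<Longrightarrow> M \<subseteq> X \<Longrightarrow> X = M"
    by metis
  have M: "derivation_graph M" "G \<subseteq> M" using M_in by (auto simp: \<A>_def)
  have max: "X = M" if "derivation_graph X" "M \<subseteq> X" for X
    using that M(2) by (intro M_max) (auto simp: \<A>_def)
  have sub: "dual_subring M" using M by (simp add: derivation_graph_def)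
  have "\<exists>w. (u, w) \<in> M" for u
  proof -
    obtain M' w where "derivation_graph M'" "M \<subseteq> M'" "(u, w) \<in> M'"
      by (rule derivation_graph_extend[OF M(1)])
    then show ?thesis using max by blast
  qed
  then obtain D where D: "\<And>u. (u, D u) \<in> M" by metis
  have D_eq: "D x = a" if "(x, a) \<in> M" for x a
    using derivation_graph_unique[OF M(1) D that] .
  show ?thesis
  proof (rule that)
    show "is_derivation D"
      unfolding is_derivation_def
      by (intro conjI allI D_eq dual_add[OF sub D D] dual_mult[OF sub D D])
    show "D x = a" if "(x, a) \<in> G" for x a using that M(2) D_eq by blast
  qed
qed

subsection \<open>Generic points\<close>

datatype 'v pexpr = PVar 'v | PConst int | PAdd "'v pexpr" "'v pexpr" | PMult "'v pexpr" "'v pexpr"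

text \<open>Polynomials are represented by syntax for the sake of this instance: the exceptional set
  of generic points becomes a countable union of null sets.\<close>

instance pexpr :: (countable) countable
  by countable_datatype

primrec peval :: "'v pexpr \<Rightarrow> ('v \<Rightarrow> 'a::comm_ring_1) \<Rightarrow> 'a" where
  "peval (PVar v) \<zeta> = \<zeta> v"
| "peval (PConst c) \<zeta> = of_int c"
| "peval (PAdd e f) \<zeta> = peval e \<zeta> + peval f \<zeta>"
| "peval (PMult e f) \<zeta> = peval e \<zeta> * peval f \<zeta>"

lemma peval_fun_simps:
  "peval (PConst c) = (\<lambda>\<zeta>. of_int c)"
  "peval (PAdd e f) = (\<lambda>\<zeta>. peval e \<zeta> + peval f \<zeta>)"
  "peval (PMult e f) = (\<lambda>\<zeta>. peval e \<zeta> * peval f \<zeta>)"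
  by (simp_all add: fun_eq_iff)

primrec pvars :: "'v pexpr \<Rightarrow> 'v set" where
  "pvars (PVar v) = {v}"
| "pvars (PConst c) = {}"
| "pvars (PAdd e f) = pvars e \<union> pvars f"
| "pvars (PMult e f) = pvars e \<union> pvars f"

definition int_polynomial :: "'v set \<Rightarrow> (('v \<Rightarrow> 'a::comm_ring_1) \<Rightarrow> 'a) \<Rightarrow> bool" where
  "int_polynomial J f \<longleftrightarrow> (\<exists>e. pvars e \<subseteq> J \<and> f = peval e)"

lemma int_polynomial_var: "v \<in> J \<Longrightarrow> int_polynomial J (\<lambda>\<zeta>. \<zeta> v)"
  unfolding int_polynomial_def by (rule exI[of _ "PVar v"]) auto

lemma int_polynomial_of_int: "int_polynomial J (\<lambda>\<zeta>. of_int c)"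
  unfolding int_polynomial_def by (rule exI[of _ "PConst c"]) auto

lemma int_polynomial_of_nat: "int_polynomial J (\<lambda>\<zeta>. of_nat n)"
  using int_polynomial_of_int[of J "int n"] by simp

lemma int_polynomial_0: "int_polynomial J (\<lambda>\<zeta>. 0)"
  and int_polynomial_1: "int_polynomial J (\<lambda>\<zeta>. 1)"
  using int_polynomial_of_int[of J 0] int_polynomial_of_int[of J 1] by simp_all

lemma int_polynomial_add:
  assumes "int_polynomial J f" "int_polynomial J g"
  shows "int_polynomial J (\<lambda>\<zeta>. f \<zeta> + g \<zeta>)"
proof -
  obtain e e' where "pvars e \<subseteq> J" "f = peval e" "pvars e' \<subseteq> J" "g = peval e'"
    using assms unfolding int_polynomial_def by blast
  then show ?thesis
    unfolding int_polynomial_def by (intro exI[of _ "PAdd e e'"]) auto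
qed

lemma int_polynomial_mult:
  assumes "int_polynomial J f" "int_polynomial J g"
  shows "int_polynomial J (\<lambda>\<zeta>. f \<zeta> * g \<zeta>)"
proof -
  obtain e e' where "pvars e \<subseteq> J" "f = peval e" "pvars e' \<subseteq> J" "g = peval e'"
    using assms unfolding int_polynomial_def by blast
  then show ?thesis
    unfolding int_polynomial_def by (intro exI[of _ "PMult e e'"]) auto
qed

lemma int_polynomial_minus: "int_polynomial J f \<Longrightarrow> int_polynomial J (\<lambda>\<zeta>. - f \<zeta>)"
  using int_polynomial_mult[OF int_polynomial_of_int[of J "-1"]] by simp

lemma int_polynomial_sum:
  "(\<And>i. i \<in> I \<Longrightarrow> int_polynomial J (f i)) \<Longrightarrow> int_polynomial J (\<lambda>\<zeta>. \<Sum>i\<in>I. f i \<zeta>)"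
  by (induction I rule: infinite_finite_induct) (simp_all add: int_polynomial_0 int_polynomial_add)

lemma int_polynomial_prod:
  "(\<And>i. i \<in> I \<Longrightarrow> int_polynomial J (f i)) \<Longrightarrow> int_polynomial J (\<lambda>\<zeta>. \<Prod>i\<in>I. f i \<zeta>)"
  by (induction I rule: infinite_finite_induct) (simp_all add: int_polynomial_1 int_polynomial_mult)

lemma int_polynomial_power: "int_polynomial J f \<Longrightarrow> int_polynomial J (\<lambda>\<zeta>. f \<zeta> ^ n)"
  by (induction n) (simp_all add: int_polynomial_1 int_polynomial_mult)

lemma int_polynomial_if:
  "(c \<Longrightarrow> int_polynomial J f) \<Longrightarrow> (\<not> c \<Longrightarrow> int_polynomial J g) \<Longrightarrow>
    int_polynomial J (\<lambda>\<zeta>. if c then f \<zeta> else g \<zeta>)"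
  by (cases c) simp_all

lemmas int_polynomial_intros =
  int_polynomial_var int_polynomial_of_int int_polynomial_of_nat int_polynomial_0 int_polynomial_1
  int_polynomial_add int_polynomial_mult int_polynomial_minus int_polynomial_sum int_polynomial_prod
  int_polynomial_power

lemma int_polynomial_mono: "int_polynomial J f \<Longrightarrow> J \<subseteq> J' \<Longrightarrow> int_polynomial J' f"
  unfolding int_polynomial_def by blast

lemma int_polynomial_cong:
  assumes "int_polynomial J f" "\<And>v. v \<in> J \<Longrightarrow> \<zeta> v = \<eta> v"
  shows "f \<zeta> = f \<eta>"
proof -
  obtain e where "pvars e \<subseteq> J" "f = peval e" using assms(1) unfolding int_polynomial_def by blast
  moreover have "pvars e \<subseteq> J \<Longrightarrow> peval e \<zeta> = peval e \<eta>"
    by (induction e) (auto simp: assms(2))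
  ultimately show ?thesis by simp
qed

text \<open>Collecting powers of one variable gives a univariate polynomial \<open>P \<zeta>\<close>
  whose coefficients depend polynomially on the other variables; this drives the induction on the
  number of variables.\<close>

lemma int_polynomial_expand:
  fixes f :: "('v \<Rightarrow> 'a::comm_ring_1) \<Rightarrow> 'a"
  assumes "int_polynomial (insert x J) f"
  obtains P where "\<And>j. int_polynomial J (\<lambda>\<zeta>. coeff (P \<zeta>) j)" "\<And>\<zeta>. f \<zeta> = poly (P \<zeta>) (\<zeta> x)"
proof -
  obtain e where e: "pvars e \<subseteq> insert x J" "f = peval e"
    using assms unfolding int_polynomial_def by blast
  have "\<exists>P. (\<forall>j. int_polynomial J (\<lambda>\<zeta>. coeff (P \<zeta>) j)) \<and> (\<forall>\<zeta>::'v \<Rightarrow> 'a. peval e \<zeta> = poly (P \<zeta>) (\<zeta> x))"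
    using e(1)
  proof (induction e)
    case (PVar v)
    show ?case
    proof (cases "v = x")
      case True
      then show ?thesis
        by (intro exI[of _ "\<lambda>\<zeta>. [:0, 1:]"])
          (auto simp: coeff_pCons int_polynomial_intros split: nat.splits)
    next
      case False
      then have "v \<in> J" using PVar by auto
      have "int_polynomial J (\<lambda>\<zeta>. coeff [:\<zeta> v:] j)" for j
        using \<open>v \<in> J\<close> by (cases j) (auto simp: int_polynomial_intros)
      then show ?thesis
        by (intro exI[of _ "\<lambda>\<zeta>. [:\<zeta> v:]"]) auto
    qed
  next
    case (PConst c)
    have "int_polynomial J (\<lambda>\<zeta>. coeff [:of_int c:] j)" for j
      by (cases j) (auto simp: int_polynomial_intros)
    then show ?case
      by (intro exI[of _ "\<lambda>\<zeta>. [:of_int c:]"]) auto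
  next
    case (PAdd e1 e2)
    then obtain P Q where
      "\<forall>j. int_polynomial J (\<lambda>\<zeta>. coeff (P \<zeta>) j)" "\<forall>\<zeta>::'v \<Rightarrow> 'a. peval e1 \<zeta> = poly (P \<zeta>) (\<zeta> x)"
      "\<forall>j. int_polynomial J (\<lambda>\<zeta>. coeff (Q \<zeta>) j)" "\<forall>\<zeta>::'v \<Rightarrow> 'a. peval e2 \<zeta> = poly (Q \<zeta>) (\<zeta> x)"
      by auto
    then show ?case
      by (intro exI[of _ "\<lambda>\<zeta>. P \<zeta> + Q \<zeta>"]) (simp add: int_polynomial_intros)
  next
    case (PMult e1 e2)
    then obtain P Q where
      "\<forall>j. int_polynomial J (\<lambda>\<zeta>. coeff (P \<zeta>) j)" "\<forall>\<zeta>::'v \<Rightarrow> 'a. peval e1 \<zeta> = poly (P \<zeta>) (\<zeta> x)"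
      "\<forall>j. int_polynomial J (\<lambda>\<zeta>. coeff (Q \<zeta>) j)" "\<forall>\<zeta>::'v \<Rightarrow> 'a. peval e2 \<zeta> = poly (Q \<zeta>) (\<zeta> x)"
      by auto
    then show ?case
      by (intro exI[of _ "\<lambda>\<zeta>. P \<zeta> * Q \<zeta>"]) (simp add: coeff_mult int_polynomial_intros)
  qed
  then show ?thesis using e(2) that by auto
qed

section \<open>Zero sets of measure zero and generic points\<close>

lemma borel_measurable_int_polynomial:
  fixes f :: "('v \<Rightarrow> 'a::{real_normed_field, euclidean_space}) \<Rightarrow> 'a"
  assumes "int_polynomial J f"
  shows "f \<in> borel_measurable (\<Pi>\<^sub>M v\<in>J. lborel)"
proof -
  obtain e where "pvars e \<subseteq> J" "f = peval e" using assms unfolding int_polynomial_def by blast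
  moreover have "pvars e \<subseteq> J \<Longrightarrow> (peval e :: _ \<Rightarrow> 'a) \<in> borel_measurable (\<Pi>\<^sub>M v\<in>J. lborel)"
  proof (induction e)
    case (PVar v)
    then have "(\<lambda>\<zeta>. \<zeta> v :: 'a) \<in> measurable (\<Pi>\<^sub>M v\<in>J. lborel) lborel"
      by (intro measurable_component_singleton) auto
    also have "measurable (\<Pi>\<^sub>M v\<in>J. lborel :: 'a measure) lborel = borel_measurable (\<Pi>\<^sub>M v\<in>J. lborel)"
      by (rule measurable_cong_sets) auto
    finally show ?case by (simp cong: measurable_cong_simp)
  qed (auto simp: peval_fun_simps)
  ultimately show ?thesis by simp
qed

text \<open>Induction on the variables with Fubini: some coefficient of \<open>P \<eta>\<close> is
  nonzero, so by induction almost every slice of \<open>f\<close> is a nonzero univariate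
  polynomial, with finitely many roots.\<close>

lemma AE_int_polynomial_nonzero:
  fixes f :: "('v \<Rightarrow> 'a::{real_normed_field, euclidean_space}) \<Rightarrow> 'a"
  assumes "finite J" "int_polynomial J f" "f \<eta> \<noteq> 0"
  shows "AE \<zeta> in (\<Pi>\<^sub>M v\<in>J. lborel). f \<zeta> \<noteq> 0"
  using assms
proof (induction J arbitrary: f rule: finite_induct)
  case empty
  then have "f \<zeta> \<noteq> 0" for \<zeta> using int_polynomial_cong[of "{}" f \<zeta> \<eta>] by auto
  then show ?case by simp
next
  case (insert x J)
  interpret product_sigma_finite "\<lambda>_::'v. lborel :: 'a measure"
    by standard
  obtain P where P: "\<And>j. int_polynomial J (\<lambda>\<zeta>. coeff (P \<zeta>) j)" "\<And>\<zeta>. f \<zeta> = poly (P \<zeta>) (\<zeta> x)"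
    by (rule int_polynomial_expand[OF insert.prems(1)]) blast
  \<comment> \<open>The coefficients involve only variables in \<open>J\<close>, and
    \<open>x\<close> is not among them.\<close>
  have P_upd: "P (\<zeta>(x := t)) = P \<zeta>" for \<zeta> t
    by (intro poly_eqI int_polynomial_cong[OF P(1)]) (use insert.hyps in auto)
  have "P \<eta> \<noteq> 0" using insert.prems(2) P(2) by auto
  then obtain j where "coeff (P \<eta>) j \<noteq> 0" by (auto simp: poly_eq_iff)
  then have "AE \<zeta> in (\<Pi>\<^sub>M v\<in>J. lborel). coeff (P \<zeta>) j \<noteq> 0" by (rule insert.IH[OF P(1)])
  then have *: "AE \<zeta> in (\<Pi>\<^sub>M v\<in>J. lborel). P \<zeta> \<noteq> 0" by eventually_elim auto
  note meas[measurable] = borel_measurable_int_polynomial[OF insert.prems(1)]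
  let ?M = "\<Pi>\<^sub>M v\<in>insert x J. lborel :: 'a measure"
  let ?Z = "{\<zeta> \<in> space ?M. f \<zeta> = 0}"
  have Z: "?Z \<in> sets ?M" by measurable
  have "emeasure ?M ?Z = (\<integral>\<^sup>+\<zeta>. indicator ?Z \<zeta> \<partial>?M)" using Z by simp
  also have "\<dots> = (\<integral>\<^sup>+\<zeta>. (\<integral>\<^sup>+t. indicator ?Z (\<zeta>(x := t)) \<partial>lborel) \<partial>(\<Pi>\<^sub>M v\<in>J. lborel))"
    using insert.hyps Z by (intro product_nn_integral_insert) auto
  also have "\<dots> = (\<integral>\<^sup>+\<zeta>. 0 \<partial>(\<Pi>\<^sub>M v\<in>J. lborel :: 'a measure))"
  proof (rule nn_integral_cong_AE, use * in eventually_elim)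
    fix \<zeta> :: "'v \<Rightarrow> 'a" assume "P \<zeta> \<noteq> 0"
    then have "{t. poly (P \<zeta>) t = 0} \<in> null_sets lborel"
      by (intro finite_imp_null_set_lborel poly_roots_finite)
    then have "AE t in lborel. poly (P \<zeta>) t \<noteq> 0" by (rule AE_I') auto
    then have "AE t in lborel. indicator ?Z (\<zeta>(x := t)) = (0::ennreal)"
      by eventually_elim (auto simp: P(2) P_upd)
    then show "(\<integral>\<^sup>+t. indicator ?Z (\<zeta>(x := t)) \<partial>lborel) = 0"
      by (subst nn_integral_cong_AE[where v = "\<lambda>_. 0"]) auto
  qed
  finally have "emeasure ?M ?Z = 0" by simp
  then show ?case using Z by (intro AE_I[where N = ?Z]) auto
qed

text \<open>Over a field of characteristic 0 this is algebraic independence of the coordinates in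
  \<open>J\<close> over the rationals, since there a polynomial vanishing as a function is the zero
  polynomial.\<close>

definition generic_point :: "'v set \<Rightarrow> ('v \<Rightarrow> 'a::comm_ring_1) \<Rightarrow> bool" where
  "generic_point J \<zeta> \<longleftrightarrow> (\<forall>f. int_polynomial J f \<longrightarrow> f \<zeta> = 0 \<longrightarrow> (\<forall>\<eta>. f \<eta> = 0))"

text \<open>Reduces a nonvanishing claim at generic parameters to one explicit
  specialisation.\<close>

lemma generic_pointD:
  "generic_point J \<zeta> \<Longrightarrow> int_polynomial J f \<Longrightarrow> f \<eta> \<noteq> 0 \<Longrightarrow> f \<zeta> \<noteq> 0"
  unfolding generic_point_def by blast

lemma AE_generic_point:
  fixes J :: "'v::countable set"
  assumes "finite J"
  shows "AE \<zeta> in (\<Pi>\<^sub>M v\<in>J. lborel :: 'a::{real_normed_field, euclidean_space} measure). generic_point J \<zeta>"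
proof -
  have "AE \<zeta> in (\<Pi>\<^sub>M v\<in>J. lborel :: 'a measure).
      pvars e \<subseteq> J \<longrightarrow> peval e \<zeta> = 0 \<longrightarrow> (\<forall>\<eta>::'v \<Rightarrow> 'a. peval e \<eta> = 0)" for e
  proof (cases "pvars e \<subseteq> J \<and> (\<exists>\<eta>::'v \<Rightarrow> 'a. peval e \<eta> \<noteq> 0)")
    case True
    then obtain \<eta> :: "'v \<Rightarrow> 'a" where \<eta>: "peval e \<eta> \<noteq> 0" by blast
    have "int_polynomial J (peval e :: _ \<Rightarrow> 'a)" using True unfolding int_polynomial_def by blast
    from AE_int_polynomial_nonzero[OF assms this \<eta>] show ?thesis by eventually_elim auto
  qed auto
  then have "AE \<zeta> in (\<Pi>\<^sub>M v\<in>J. lborel :: 'a measure).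
      \<forall>e. pvars e \<subseteq> J \<longrightarrow> peval e \<zeta> = 0 \<longrightarrow> (\<forall>\<eta>::'v \<Rightarrow> 'a. peval e \<eta> = 0)"
    by (subst AE_all_countable) blast
  then show ?thesis
    by eventually_elim (auto simp: generic_point_def int_polynomial_def)
qed

text \<open>Integer polynomials in the other coordinates are made constants and
  \<open>\<zeta> x\<close> receives the value 1. No relation obstructs this, because
  \<open>\<zeta> x\<close> is transcendental over those constants.\<close>

lemma generic_point_derivation:
  fixes \<zeta> :: "'v \<Rightarrow> 'a::field_char_0"
  assumes "generic_point J \<zeta>" "x \<in> J"
  obtains D where "is_derivation D" "D (\<zeta> x) = 1" "\<And>y. y \<in> J \<Longrightarrow> y \<noteq> x \<Longrightarrow> D (\<zeta> y) = 0"
proof -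
  define G where "G = {(f \<zeta>, 0 :: 'a) | f. int_polynomial (J - {x}) f}"
  have const: "(f \<zeta>, 0) \<in> G" if "int_polynomial (J - {x}) f" for f
    using that by (auto simp: G_def)
  have G: "dual_subring G"
    unfolding dual_subring_def
  proof (intro conjI allI impI)
    show "(1, 0) \<in> G" using const[OF int_polynomial_1] by simp
    fix u a v b assume "(u, a) \<in> G" "(v, b) \<in> G"
    then obtain f g where "int_polynomial (J - {x}) f" "int_polynomial (J - {x}) g"
      "u = f \<zeta>" "v = g \<zeta>" "a = 0" "b = 0" by (auto simp: G_def)
    then show "(u + v, a + b) \<in> G" "(u * v, a * v + u * b) \<in> G" "(- u, - a) \<in> G"
      using const[OF int_polynomial_add] const[OF int_polynomial_mult] const[OF int_polynomial_minus]
      by fastforce+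
  qed
  have "derivation_graph (dual_adjoin G (\<zeta> x) 1)"
  proof (rule derivation_graph_adjoin[OF G])
    fix f h assume fh: "coeffs_in G f h" "poly f (\<zeta> x) = 0"
    have "h = 0" using fh(1) by (auto simp: coeffs_in_def G_def poly_eq_iff)
    have "\<forall>i. \<exists>g. int_polynomial (J - {x}) g \<and> coeff f i = g \<zeta>"
      using fh(1) by (auto simp: coeffs_in_def G_def)
    then obtain g where g: "\<And>i. int_polynomial (J - {x}) (g i)" "\<And>i. coeff f i = g i \<zeta>" by metis
    \<comment> \<open>A relation for \<open>\<zeta> x\<close> lifts to an integer polynomial in all
      variables. It vanishes at the generic point, hence identically, so \<open>f\<close> vanishes
      at every \<open>s\<close> substituted for \<open>\<zeta> x\<close>.\<close>
    define F where "F = (\<lambda>\<xi>. \<Sum>i\<le>degree f. g i \<xi> * \<xi> x ^ i)"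
    have F: "int_polynomial J F"
      unfolding F_def using assms(2) g(1)
      by (intro int_polynomial_intros) (auto intro: int_polynomial_mono)
    have "F \<zeta> = 0" using fh(2) by (simp add: F_def poly_altdef g(2))
    then have F0: "F \<xi> = 0" for \<xi> using assms(1) F by (auto simp: generic_point_def)
    have "poly f s = 0" for s
    proof -
      have "g i (\<zeta>(x := s)) = g i \<zeta>" for i
        by (rule int_polynomial_cong[OF g(1)]) auto
      then have "poly f s = F (\<zeta>(x := s))" by (simp add: F_def poly_altdef g(2))
      then show ?thesis using F0 by simp
    qed
    then have "f = 0" using poly_all_0_iff_0 by blast
    then show "dual_eval (\<zeta> x) 1 f h = 0" using \<open>h = 0\<close> by (simp add: dual_eval_def)
  qed
  then obtain D where D: "is_derivation D" "\<And>u a. (u, a) \<in> dual_adjoin G (\<zeta> x) 1 \<Longrightarrow> D u = a"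
    by (rule derivation_extension) blast
  show ?thesis
  proof (rule that[OF D(1)])
    show "D (\<zeta> x) = 1" using D(2) dual_adjoin_new[OF G] by blast
    fix y assume "y \<in> J" "y \<noteq> x"
    then have "(\<zeta> y, 0) \<in> G" by (intro const int_polynomial_var) auto
    then show "D (\<zeta> y) = 0" using D(2) dual_adjoin_superset[OF G] by blast
  qed
qed

subsection \<open>Spanning by tangent vectors\<close>

lemma det_mat_eq_0_iff:
  fixes g :: "nat \<Rightarrow> nat \<Rightarrow> 'a::field"
  shows "det (mat m m (\<lambda>(i, n). g i n)) = 0 \<longleftrightarrow>
    (\<exists>v. (\<exists>n<m. v n \<noteq> 0) \<and> (\<forall>i<m. (\<Sum>n<m. g i n * v n) = 0))" (is "det ?A = 0 \<longleftrightarrow> ?R")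
proof -
  have A: "?A \<in> carrier_mat m m" by simp
  have mult: "(?A *\<^sub>v vec m v) $ i = (\<Sum>n<m. g i n * v n)" if "i < m" for i and v :: "nat \<Rightarrow> 'a"
    using that by (simp add: scalar_prod_def lessThan_atLeast0)
  show ?thesis
  proof
    assume "det ?A = 0"
    then obtain v where v: "v \<in> carrier_vec m" "v \<noteq> 0\<^sub>v m" "?A *\<^sub>v v = 0\<^sub>v m"
      using det_0_iff_vec_prod_zero_field[OF A] by blast
    have "vec m (\<lambda>n. v $ n) = v" using v(1) by auto
    then have "(\<Sum>n<m. g i n * v $ n) = 0" if "i < m" for i
      using mult[OF that, of "\<lambda>n. v $ n"] v(3) that by simp
    moreover have "\<exists>n<m. v $ n \<noteq> 0" using v(1,2) by (auto simp: vec_eq_iff)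
    ultimately show ?R by blast
  next
    assume ?R
    then obtain v where v: "\<exists>n<m. v n \<noteq> 0" "\<And>i. i < m \<Longrightarrow> (\<Sum>n<m. g i n * v n) = 0" by blast
    have "?A *\<^sub>v vec m v = 0\<^sub>v m"
    proof (rule eq_vecI)
      fix i assume "i < dim_vec (0\<^sub>v m :: 'a vec)"
      then have "i < m" by simp
      then show "(?A *\<^sub>v vec m v) $ i = 0\<^sub>v m $ i" using mult[of i v] v(2)[of i] by simp
    qed simp
    moreover have "vec m v \<noteq> 0\<^sub>v m" using v(1) by (auto simp: vec_eq_iff)
    ultimately show "det ?A = 0"
      unfolding det_0_iff_vec_prod_zero_field[OF A] by (intro exI[of _ "vec m v"]) simp
  qed
qed

text \<open>Padded with zero rows, the \<open>d\<close> vectors form a singular square matrix, which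
  has a nonzero kernel vector.\<close>

lemma exists_annihilator:
  fixes u :: "nat \<Rightarrow> nat \<Rightarrow> 'a::field"
  assumes "d < m"
  obtains v where "\<exists>n<m. v n \<noteq> 0" "\<And>i. i < d \<Longrightarrow> (\<Sum>n<m. u i n * v n) = 0"
proof -
  let ?g = "\<lambda>i n. if i < d then u i n else 0"
  let ?A = "mat m m (\<lambda>(i, n). ?g i n)"
  have "?A\<^sup>T = mat m m (\<lambda>(n, i). ?g i n)" by auto
  moreover have "det (mat m m (\<lambda>(n, i). ?g i n)) = 0"
    unfolding det_mat_eq_0_iff
    \<comment> \<open>Row \<open>d\<close> of the padded matrix is zero, so the unit vector at
      \<open>d\<close> is in the kernel of the transpose.\<close>
    using assms by (intro exI[of _ "\<lambda>i. if i = d then 1 else 0"]) (auto intro!: sum.neutral)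
  ultimately have "det ?A = 0" using det_transpose[of ?A m] by simp
  then obtain v where v: "\<exists>n<m. v n \<noteq> 0" "\<forall>i<m. (\<Sum>n<m. ?g i n * v n) = 0"
    unfolding det_mat_eq_0_iff by blast
  show ?thesis
  proof (rule that[OF v(1)])
    fix i assume "i < d"
    then show "(\<Sum>n<m. u i n * v n) = 0" using v(2)[rule_format, of i] assms by simp
  qed
qed

lemma int_polynomial_det:
  assumes "\<And>i j. i < m \<Longrightarrow> j < m \<Longrightarrow> int_polynomial J (g i j)"
  shows "int_polynomial J (\<lambda>\<zeta>. det (mat m m (\<lambda>(i, j). g i j \<zeta>)))"
proof -
  have "int_polynomial J (\<lambda>\<zeta>. \<Sum>\<pi>\<in>{\<pi>. \<pi> permutes {0..<m}}. signof \<pi> * (\<Prod>i=0..<m. g i (\<pi> i) \<zeta>))"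
    using assms
    by (intro int_polynomial_intros) (auto simp: int_polynomial_intros permutes_in_image)
  moreover have "det (mat m m (\<lambda>(i, j). g i j \<zeta>)) =
      (\<Sum>\<pi>\<in>{\<pi>. \<pi> permutes {0..<m}}. signof \<pi> * (\<Prod>i=0..<m. g i (\<pi> i) \<zeta>))" for \<zeta>
    by (auto simp: det_def permutes_in_image intro!: sum.cong prod.cong)
  ultimately show ?thesis by simp
qed

text \<open>A Vandermonde argument: the polynomial vanishing on \<open>T\<close> except at
  \<open>y\<close> has degree below \<open>d\<close>, so summing it against \<open>w\<close> gives 0
  and isolates \<open>w y\<close>.\<close>

lemma power_sums_zero:
  fixes w :: "nat \<Rightarrow> 'a::field_char_0"
  assumes "finite T" "card T \<le> d" "\<And>i. i < d \<Longrightarrow> (\<Sum>n\<in>T. of_nat n ^ i * w n) = 0" "y \<in> T"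
  shows "w y = 0"
proof -
  define f :: "'a poly" where "f = (\<Prod>x\<in>T - {y}. [:- of_nat x, 1:])"
  have "card T > 0" using assms by (auto simp: card_gt_0_iff)
  have "degree f \<le> card (T - {y})"
    unfolding f_def by (rule degree_prod_sum_le[THEN order_trans]) (use assms in auto)
  then have deg: "degree f < d" using assms \<open>card T > 0\<close> by simp
  have "0 = (\<Sum>i\<le>degree f. coeff f i * (\<Sum>n\<in>T. of_nat n ^ i * w n))"
    using deg assms(3) by simp
  also have "\<dots> = (\<Sum>n\<in>T. (\<Sum>i\<le>degree f. coeff f i * of_nat n ^ i) * w n)"
    unfolding sum_distrib_left sum_distrib_right by (subst sum.swap) (simp add: mult_ac)
  also have "\<dots> = (\<Sum>n\<in>T. poly f (of_nat n) * w n)"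
    by (simp add: poly_altdef)
  also have "\<dots> = poly f (of_nat y) * w y"
    using assms by (intro sum.remove[THEN trans]) (auto simp: f_def poly_prod intro!: sum.neutral prod_zero)
  finally have "poly f (of_nat y) * w y = 0" by simp
  moreover have "poly f (of_nat y) \<noteq> 0" using assms(1) by (auto simp: f_def poly_prod)
  ultimately show ?thesis by simp
qed

text \<open>The vectors \<open>n\<^sup>i / B\<^sub>r(n)\<close> and \<open>n\<^sup>j A\<^sub>r(n) / B\<^sub>r(n)\<^sup>2\<close> span the tangent space of the variety of sources
  at the source \<open>A\<^sub>r / B\<^sub>r\<close>. Below, \<open>k + p + q + 1\<close> of them, from \<open>k\<close> sources, form a square matrix. All are
  multiplied by \<open>\<Prod>\<^sub>s B\<^sub>s(n)\<^sup>2\<close>, so that the entries are polynomials in the parameters and denominators that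
  vanish at sample points are allowed in the specialisation showing that the determinant is not
  identically zero.\<close>

definition cofactor :: "nat \<Rightarrow> (nat \<Rightarrow> nat \<Rightarrow> 'a::field) \<Rightarrow> nat \<Rightarrow> nat \<Rightarrow> 'a" where
  "cofactor k B y n = (\<Prod>s\<in>{..<k} - {y}. (B s n)\<^sup>2)"

text \<open>The rows are all numerator directions and the denominator directions
  \<open>j = 1, ..., q\<close> of source 0, the constant numerator direction of source 1, and the
  constant denominator direction of each source 1, ..., \<open>k - 1\<close>. The case
  \<open>j = 0\<close> is left out for source 0, where scaling numerator and denominator together
  makes the directions dependent.\<close>

definition tangent_entry ::
    "nat \<Rightarrow> nat \<Rightarrow> nat \<Rightarrow> (nat \<Rightarrow> nat \<Rightarrow> 'a::field) \<Rightarrow> (nat \<Rightarrow> nat \<Rightarrow> 'a) \<Rightarrow> nat \<Rightarrow> nat \<Rightarrow> 'a" where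
  "tangent_entry p q k A B x n =
    (if x \<le> p then of_nat n ^ x * B 0 n * cofactor k B 0 n
     else if x \<le> p + q then of_nat n ^ (x - p) * A 0 n * cofactor k B 0 n
     else if x = p + q + 1 then B 1 n * cofactor k B 1 n
     else A (x - (p + q + 1)) n * cofactor k B (x - (p + q + 1)) n)"

text \<open>The source 0 is the polynomial \<open>n\<^sup>p\<close>, and the source \<open>y\<close> is \<open>1 / (n - y)\<close>, with its pole at a sample point.\<close>

lemma tangent_entry_special:
  fixes w :: "nat \<Rightarrow> 'a::field_char_0"
  assumes k: "2 \<le> k"
    and A0: "\<And>n. A 0 n = of_nat n ^ p" and B0: "\<And>n. B 0 n = 1"
    and A: "\<And>y n. 1 \<le> y \<Longrightarrow> y < k \<Longrightarrow> A y n = 1"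
    and B: "\<And>y n. 1 \<le> y \<Longrightarrow> y < k \<Longrightarrow> B y n = of_nat n - of_nat y"
    and w: "\<And>x. x < k + p + q + 1 \<Longrightarrow> (\<Sum>n=1..k+p+q+1. tangent_entry p q k A B x n * w n) = 0"
    and n: "n \<in> {1..k+p+q+1}"
  shows "w n = 0"
proof -
  define m where "m = k + p + q + 1"
  \<comment> \<open>The \<open>p + q + 2\<close> sample points that are not poles of the special
    sources.\<close>
  define T where "T = {k..m}"
  define Q where "Q = (\<lambda>n::nat. \<Prod>s\<in>{1..<k}. (of_nat n - of_nat s :: 'a)\<^sup>2)"
  have split: "(\<Sum>n=1..m. h n) = (\<Sum>n\<in>T. h n)" if "\<And>n. n \<in> {1..<k} \<Longrightarrow> h n = 0" for h :: "nat \<Rightarrow> 'a"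
    using that k by (intro sum.mono_neutral_right) (auto simp: T_def m_def)
  have Q0: "Q n = 0" if "n \<in> {1..<k}" for n using that by (auto simp: Q_def)
  have QT: "Q n \<noteq> 0" if "n \<in> T" for n using that by (auto simp: Q_def T_def)
  have cof0: "cofactor k B 0 n = Q n" for n
  proof -
    have "{..<k} - {0} = {1..<k}" by auto
    then show ?thesis unfolding cofactor_def Q_def by (auto intro!: prod.cong simp: B)
  qed
  have cof: "cofactor k B y n = (\<Prod>s\<in>{1..<k} - {y}. (of_nat n - of_nat s)\<^sup>2)" if "1 \<le> y" for y n
  proof -
    have "{..<k} - {y} = insert 0 ({1..<k} - {y})" using that k by auto
    then show ?thesis unfolding cofactor_def using B0 B by auto
  qed
  have cofQ: "(of_nat n - of_nat y)\<^sup>2 * cofactor k B y n = Q n" if "1 \<le> y" "y < k" for y n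
    unfolding cof[OF that(1)] Q_def using that by (subst prod.remove[of "{1..<k}" y]) auto
  have cof_other: "cofactor k B y n = 0" if "1 \<le> y" "n \<in> {1..<k}" "n \<noteq> y" for y n
    unfolding cof[OF that(1)] using that by (intro prod_zero) auto
  \<comment> \<open>Chosen so that the row of source 1 becomes the plain sum of \<open>v\<close>,
    while the rows of source 0 become the sums of \<open>n^x (n - 1) v n\<close>.\<close>
  define v where "v = (\<lambda>n. w n * Q n / (of_nat n - 1))"
  have one: "of_nat n - 1 \<noteq> (0::'a)" if "n \<in> T" for n
  proof -
    have "n \<noteq> 1" using that k by (auto simp: T_def)
    then show ?thesis by (metis of_nat_eq_1_iff right_minus_eq)
  qed
  have low: "(\<Sum>n\<in>T. of_nat n ^ x * (of_nat n - 1) * v n) = 0" if "x \<le> p + q" for x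
  proof -
    have "tangent_entry p q k A B x n = of_nat n ^ x * Q n" for n
      using that by (auto simp: tangent_entry_def B0 A0 cof0 power_add[symmetric])
    then have "(\<Sum>n=1..m. of_nat n ^ x * Q n * w n) = 0" using w[of x] that by (simp add: m_def)
    then have "(\<Sum>n\<in>T. of_nat n ^ x * Q n * w n) = 0" by (subst (asm) split) (auto simp: Q0)
    then show ?thesis using one by (simp add: v_def mult_ac cong: sum.cong)
  qed
  have base: "(\<Sum>n\<in>T. v n) = 0"
  proof -
    have "(\<Sum>n=1..m. B 1 n * cofactor k B 1 n * w n) = 0"
      using w[of "p + q + 1"] k by (simp add: tangent_entry_def m_def)
    moreover have "B 1 n * cofactor k B 1 n = 0" if "n \<in> {1..<k}" for n
      using that cof_other[of 1 n] B[of 1 n] k by (cases "n = 1") auto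
    ultimately have "(\<Sum>n\<in>T. B 1 n * cofactor k B 1 n * w n) = 0" by (subst (asm) split) auto
    moreover have "B 1 n * cofactor k B 1 n * w n = v n" if "n \<in> T" for n
    proof -
      have "B 1 n = of_nat n - 1" "Q n = (of_nat n - 1)\<^sup>2 * cofactor k B 1 n"
        using cofQ[of 1 n] B[of 1 n] k by simp_all
      then show ?thesis using one[OF that] by (simp add: v_def power2_eq_square)
    qed
    ultimately show ?thesis by simp
  qed
  \<comment> \<open>Each row of source 0 is a difference of two consecutive power sums; the row of
    source 1 starts the induction.\<close>
  have pow: "(\<Sum>n\<in>T. of_nat n ^ x * v n) = 0" if "x < p + q + 2" for x
    using that
  proof (induction x)
    case 0 then show ?case using base by simp
  next
    case (Suc x)
    have "(\<Sum>n\<in>T. of_nat n ^ Suc x * v n) - (\<Sum>n\<in>T. of_nat n ^ x * v n) =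
        (\<Sum>n\<in>T. of_nat n ^ x * (of_nat n - 1) * v n)"
      unfolding sum_subtractf[symmetric] by (simp add: algebra_simps)
    then show ?case using Suc low[of x] by simp
  qed
  have wT: "w n = 0" if "n \<in> T" for n
  proof -
    have "v n = 0" by (rule power_sums_zero[OF _ _ pow that]) (auto simp: T_def m_def)
    then show ?thesis using QT[OF that] one[OF that] by (simp add: v_def)
  qed
  show ?thesis
  proof (cases "n \<in> T")
    case False
    then have n1: "1 \<le> n" "n < k" using n by (auto simp: T_def m_def)
    \<comment> \<open>The denominator row of source \<open>n\<close>: its cofactor vanishes at all
      other poles and \<open>w\<close> vanishes on \<open>T\<close>, so only the entry at
      \<open>n\<close> survives.\<close>
    define x where "x = p + q + 1 + n"
    have "x < m" using n1 by (simp add: x_def m_def)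
    have entry: "(\<Sum>i=1..m. cofactor k B n i * w i) = 0"
    proof -
      have "tangent_entry p q k A B x i = cofactor k B n i" for i
        using n1 by (simp add: tangent_entry_def x_def A)
      then show ?thesis using w[of x] \<open>x < m\<close> by (simp add: m_def)
    qed
    have "(\<Sum>i=1..m. cofactor k B n i * w i) = (\<Sum>i\<in>{n}. cofactor k B n i * w i)"
    proof (intro sum.mono_neutral_right ballI)
      fix i assume "i \<in> {1..m} - {n}"
      then show "cofactor k B n i * w i = 0"
        using cof_other[OF n1(1), of i] wT[of i] by (cases "i < k") (auto simp: T_def)
    qed (use n1 in \<open>auto simp: m_def\<close>)
    then have "cofactor k B n n * w n = 0" using entry by simp
    moreover have "cofactor k B n n \<noteq> 0" unfolding cof[OF n1(1)] by auto
    ultimately show ?thesis by simp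
  qed (rule wT)
qed

section \<open>Derivations applied to sources\<close>

lemma
  assumes "is_derivation D"
  shows derivation_add: "D (x + y) = D x + D y"
    and derivation_mult: "D (x * y) = D x * y + x * D y"
  using assms by (auto simp: is_derivation_def)

lemma derivation_0: "is_derivation D \<Longrightarrow> D 0 = 0"
  using derivation_add[of D 0 0] by simp

lemma derivation_1: "is_derivation D \<Longrightarrow> D 1 = 0"
  using derivation_mult[of D 1 1] by simp

lemma derivation_of_nat: "is_derivation D \<Longrightarrow> D (of_nat n) = 0"
  by (induction n) (simp_all add: derivation_0 derivation_1 derivation_add)

lemma derivation_sum: "is_derivation D \<Longrightarrow> D (sum f I) = (\<Sum>i\<in>I. D (f i))"
  by (induction I rule: infinite_finite_induct) (simp_all add: derivation_0 derivation_add)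

lemma derivation_divide:
  assumes "is_derivation D" "y \<noteq> 0"
  shows "D (x / y) = (D x * y - x * D y) / y\<^sup>2"
proof -
  have "D x = D (x / y) * y + x / y * D y"
    using derivation_mult[OF assms(1), of "x / y" y] assms(2) by simp
  then show ?thesis using assms(2) by (simp add: field_simps power2_eq_square)
qed

lemma derivation_mult_of_nat_power:
  "is_derivation D \<Longrightarrow> D (x * of_nat n ^ i) = D x * of_nat n ^ i"
  using derivation_mult[of D x "of_nat (n ^ i)"] derivation_of_nat[of D "n ^ i"] by simp

text \<open>Sample points are natural numbers, hence constants, so a derivation acts on the
  coefficients only.\<close>

lemma derivation_numerator:
  "is_derivation D \<Longrightarrow> D (numerator p \<zeta> n) = numerator p (\<lambda>i. D (\<zeta> i)) n"
  by (simp add: numerator_def derivation_sum derivation_mult_of_nat_power)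

lemma derivation_denominator:
  "is_derivation D \<Longrightarrow> D (denominator p q \<zeta> n) = denominator p q (\<lambda>i. D (\<zeta> i)) n"
  by (simp add: denominator_def derivation_sum derivation_mult_of_nat_power)

definition params :: "nat \<Rightarrow> nat \<Rightarrow> nat \<Rightarrow> (nat \<times> nat) set" where
  "params p q R = {..<R} \<times> {..<p + q + 2}"

lemma int_polynomial_numerator:
  "r < R \<Longrightarrow> int_polynomial (params p q R) (\<lambda>\<zeta>. numerator p (\<lambda>i. \<zeta> (r, i)) n)"
  unfolding numerator_def params_def by (intro int_polynomial_intros) auto

lemma int_polynomial_denominator:
  "r < R \<Longrightarrow> int_polynomial (params p q R) (\<lambda>\<zeta>. denominator p q (\<lambda>i. \<zeta> (r, i)) n)"
  unfolding denominator_def params_def by (intro int_polynomial_intros) auto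

lemma generic_numerator_nonzero:
  assumes "generic_point (params p q R) (\<zeta> :: _ \<Rightarrow> 'a::field_char_0)" "r < R"
  shows "numerator p (\<lambda>i. \<zeta> (r, i)) n \<noteq> 0"
proof (rule generic_pointD[OF assms(1) int_polynomial_numerator[OF assms(2)]])
  have "(\<Sum>i\<le>p. (if i = 0 then 1 else 0) * of_nat n ^ i) = (1::'a)"
    by (subst sum.remove[of _ 0]) (auto intro!: sum.neutral)
  then show "numerator p (\<lambda>i. (\<lambda>(r, i). if i = 0 then 1 else 0) (r, i)) n \<noteq> (0::'a)"
    by (simp add: numerator_def)
qed

lemma generic_denominator_nonzero:
  assumes "generic_point (params p q R) (\<zeta> :: _ \<Rightarrow> 'a::field_char_0)" "r < R"
  shows "denominator p q (\<lambda>i. \<zeta> (r, i)) n \<noteq> 0"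
proof (rule generic_pointD[OF assms(1) int_polynomial_denominator[OF assms(2)]])
  have "(\<Sum>j\<le>q. (if j = 0 then 1 else 0) * of_nat n ^ j) = (1::'a)"
    by (subst sum.remove[of _ 0]) (auto intro!: sum.neutral)
  then show "denominator p q (\<lambda>i. (\<lambda>(r, i). if i = p + 1 then 1 else 0) (r, i)) n \<noteq> (0::'a)"
    by (simp add: denominator_def)
qed

text \<open>The determinant is an integer polynomial in the parameters, and the special sources show
  that it is not identically zero. \<open>e\<close> selects the \<open>k\<close> sources among the
  \<open>R\<close> available ones.\<close>

lemma generic_tangent_det_nonzero:
  fixes \<zeta> :: "nat \<times> nat \<Rightarrow> 'a::field_char_0"
  assumes "generic_point (params p q R) \<zeta>" "inj_on e {..<k}" "e ` {..<k} \<subseteq> {..<R}" "2 \<le> k" "1 \<le> q"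
  defines "m \<equiv> k + p + q + 1"
  shows "det (mat m m (\<lambda>(x, n). tangent_entry p q k
      (\<lambda>y n. numerator p (\<lambda>i. \<zeta> (e y, i)) n) (\<lambda>y n. denominator p q (\<lambda>i. \<zeta> (e y, i)) n) x (Suc n))) \<noteq> 0"
proof -
  let ?A = "\<lambda>\<zeta> :: nat \<times> nat \<Rightarrow> 'a. \<lambda>y n. numerator p (\<lambda>i. \<zeta> (e y, i)) n"
  let ?B = "\<lambda>\<zeta> :: nat \<times> nat \<Rightarrow> 'a. \<lambda>y n. denominator p q (\<lambda>i. \<zeta> (e y, i)) n"
  \<comment> \<open>Source 0 has \<open>a\<^sub>p = b\<^sub>0 = 1\<close>; source \<open>y\<close>
    has \<open>a\<^sub>0 = b\<^sub>1 = 1\<close> and \<open>b\<^sub>0 = - y\<close>. The entry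
    \<open>b\<^sub>1\<close> exists because \<open>1 \<le> q\<close>.\<close>
  define f where "f = (\<lambda>y i. if y = 0 then (if i = p \<or> i = p + 1 then 1 else 0)
    else (if i = 0 \<or> i = p + 2 then 1 else if i = p + 1 then - of_nat y else (0::'a)))"
  define \<eta> where "\<eta> = (\<lambda>(r, i). f (inv_into {..<k} e r) i)"
  have \<eta>: "\<eta> (e y, i) = f y i" if "y < k" for y i
    using that assms(2) by (simp add: \<eta>_def)
  have numer: "numerator p h n = of_nat n ^ i0"
    if "i0 \<le> p" "\<And>i. i \<le> p \<Longrightarrow> h i = (if i = i0 then 1 else 0)" for h :: "nat \<Rightarrow> 'a" and n i0
    unfolding numerator_def using that by (subst sum.remove[of _ i0]) (auto intro!: sum.neutral)
  have A0: "?A \<eta> 0 n = of_nat n ^ p" for n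
    using assms(4) by (intro numer) (auto simp: \<eta> f_def)
  have A1: "?A \<eta> y n = 1" if "1 \<le> y" "y < k" for y n
    using that by (subst numer[of 0]) (auto simp: \<eta> f_def)
  have B0: "?B \<eta> 0 n = 1" for n
    unfolding denominator_def using assms(4)
    by (subst sum.remove[of _ 0]) (auto simp: \<eta> f_def intro!: sum.neutral)
  have B1: "?B \<eta> y n = of_nat n - of_nat y" if "1 \<le> y" "y < k" for y n
  proof -
    have "?B \<eta> y n = (\<Sum>j\<in>{0, 1}. \<eta> (e y, p + 1 + j) * of_nat n ^ j)"
      unfolding denominator_def using assms(5) that
      by (intro sum.mono_neutral_right) (auto simp: \<eta> f_def)
    then show ?thesis using that by (simp add: \<eta> f_def)
  qed
  have e: "e y < R" if "y < k" for y using that assms(3) by blast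
  show ?thesis
  proof (rule generic_pointD[OF assms(1)])
    show "int_polynomial (params p q R) (\<lambda>\<zeta>. det (mat m m (\<lambda>(x, n). tangent_entry p q k (?A \<zeta>) (?B \<zeta>) x (Suc n))))"
    proof (rule int_polynomial_det)
      fix x n assume "x < m"
      then have "x - (p + q + 1) < k" using assms(4) by (auto simp: m_def)
      then show "int_polynomial (params p q R) (\<lambda>\<zeta>. tangent_entry p q k (?A \<zeta>) (?B \<zeta>) x (Suc n))"
        unfolding tangent_entry_def cofactor_def using e assms(4)
        by (intro int_polynomial_if int_polynomial_intros int_polynomial_numerator
            int_polynomial_denominator) auto
    qed
    show "det (mat m m (\<lambda>(x, n). tangent_entry p q k (?A \<eta>) (?B \<eta>) x (Suc n))) \<noteq> 0"
    proof
      assume "det (mat m m (\<lambda>(x, n). tangent_entry p q k (?A \<eta>) (?B \<eta>) x (Suc n))) = 0"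
      then obtain v where v: "\<exists>n<m. v n \<noteq> 0"
        "\<And>x. x < m \<Longrightarrow> (\<Sum>n<m. tangent_entry p q k (?A \<eta>) (?B \<eta>) x (Suc n) * v n) = 0"
        unfolding det_mat_eq_0_iff by blast
      have shift: "(\<Sum>n=1..k+p+q+1. h n) = (\<Sum>n<m. h (Suc n))" for h :: "nat \<Rightarrow> 'a"
        by (rule sum.reindex_bij_witness[of _ Suc "\<lambda>n. n - 1"]) (auto simp: m_def)
      have sum0: "(\<Sum>n=1..k+p+q+1. tangent_entry p q k (?A \<eta>) (?B \<eta>) x n * v (n - 1)) = 0"
        if "x < k + p + q + 1" for x
        unfolding shift diff_Suc_1 using v(2)[of x] that by (simp add: m_def)
      have "v (n - 1) = 0" if "n \<in> {1..k+p+q+1}" for n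
        by (rule tangent_entry_special[where A = "?A \<eta>" and B = "?B \<eta>", OF assms(4) A0 B0 A1 B1 sum0 that])
      from this[of "Suc _"] v(1) show False by (auto simp: m_def)
    qed
  qed
qed

text \<open>A numerator times a denominator is a polynomial of degree at most \<open>p + q\<close>,
  a combination of the annihilated powers.\<close>

lemma annihilates_product:
  fixes v :: "nat \<Rightarrow> 'a::field"
  assumes "\<And>i. i \<le> p + q \<Longrightarrow> (\<Sum>n<m. of_nat (Suc n) ^ i / (h n)\<^sup>2 * v n) = 0"
  shows "(\<Sum>n<m. numerator p x (Suc n) * denominator p q y (Suc n) / (h n)\<^sup>2 * v n) = 0"
proof -
  have "(\<Sum>n<m. numerator p x (Suc n) * denominator p q y (Suc n) / (h n)\<^sup>2 * v n) =
      (\<Sum>n<m. \<Sum>i\<le>p. \<Sum>j\<le>q. x i * y (p + 1 + j) * (of_nat (Suc n) ^ (i + j) / (h n)\<^sup>2 * v n))"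
    unfolding numerator_def denominator_def sum_product unfolding sum_divide_distrib sum_distrib_right
    by (simp add: power_add mult_ac del: of_nat_Suc)
  also have "\<dots> = (\<Sum>i\<le>p. \<Sum>n<m. \<Sum>j\<le>q. x i * y (p + 1 + j) * (of_nat (Suc n) ^ (i + j) / (h n)\<^sup>2 * v n))"
    by (rule sum.swap)
  also have "\<dots> = (\<Sum>i\<le>p. \<Sum>j\<le>q. \<Sum>n<m. x i * y (p + 1 + j) * (of_nat (Suc n) ^ (i + j) / (h n)\<^sup>2 * v n))"
    by (intro sum.cong refl sum.swap)
  also have "\<dots> = (\<Sum>i\<le>p. \<Sum>j\<le>q. x i * y (p + 1 + j) * (\<Sum>n<m. of_nat (Suc n) ^ (i + j) / (h n)\<^sup>2 * v n))"
    by (simp add: sum_distrib_left)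
  also have "\<dots> = 0" using assms by (intro sum.neutral ballI) (simp del: of_nat_Suc)
  finally show ?thesis .
qed

text \<open>A dimension count gives a nonzero \<open>v\<close> orthogonal to the sources and to the
  powers divided by the squared denominator. Derivations make it orthogonal to the tangent vectors
  too, against the nonsingularity of their matrix.\<close>

lemma generic_combination_not_rational:
  fixes \<zeta> :: "nat \<times> nat \<Rightarrow> 'a::field_char_0"
  assumes gen: "generic_point (params p q R) \<zeta>"
    and I: "I \<subseteq> {..<R}" "2 \<le> card I" and q: "1 \<le> q"
    and m: "m = card I + p + q + 1"
    and c: "\<And>r. r \<in> I \<Longrightarrow> c r \<noteq> 0"
    and \<eta>: "admissible p q m \<eta>"
    and eq: "\<And>n. n < m \<Longrightarrow>
      (\<Sum>r\<in>I. c r * (numerator p (\<lambda>i. \<zeta> (r, i)) (Suc n) / denominator p q (\<lambda>i. \<zeta> (r, i)) (Suc n))) =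
      numerator p \<eta> (Suc n) / denominator p q \<eta> (Suc n)"
  shows False
proof -
  define k where "k = card I"
  have finI: "finite I" using I(1) finite_subset by blast
  define a where "a = (\<lambda>r n. numerator p (\<lambda>i. \<zeta> (r, i)) (Suc n))"
  define b where "b = (\<lambda>r n. denominator p q (\<lambda>i. \<zeta> (r, i)) (Suc n))"
  define \<alpha> where "\<alpha> = (\<lambda>n. numerator p \<eta> (Suc n))"
  define \<beta> where "\<beta> = (\<lambda>n. denominator p q \<eta> (Suc n))"
  have b0: "b r n \<noteq> 0" if "r \<in> I" for r n
    unfolding b_def using gen that I(1) by (intro generic_denominator_nonzero) auto
  have \<beta>0: "\<beta> n \<noteq> 0" if "n < m" for n
    using \<eta> that by (auto simp: admissible_def \<beta>_def)
  have eq': "(\<Sum>r\<in>I. c r * (a r n / b r n)) = \<alpha> n / \<beta> n" if "n < m" for n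
    using eq[OF that] by (simp add: a_def b_def \<alpha>_def \<beta>_def)
  obtain e where e: "bij_betw e {..<k} I"
    using ex_bij_betw_nat_finite[OF finI] by (auto simp: k_def lessThan_atLeast0)
  have eI: "e y \<in> I" if "y < k" for y using e that by (auto simp: bij_betw_def)
  \<comment> \<open>These are \<open>p + q + 1\<close> powers and the sources
    \<open>e 1, ..., e (k - 1)\<close>, one vector fewer than \<open>m\<close>. Source
    \<open>e 0\<close> is omitted because the assumed relation recovers it.\<close>
  define u where "u = (\<lambda>x n. if x \<le> p + q then of_nat (Suc n) ^ x / (\<beta> n)\<^sup>2
    else a (e (x - (p + q))) n / b (e (x - (p + q))) n)"
  have "p + q + k < m" by (simp add: m k_def)
  then obtain v where v: "\<exists>n<m. v n \<noteq> 0" and uv: "\<And>x. x < p + q + k \<Longrightarrow> (\<Sum>n<m. u x n * v n) = 0"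
    by (rule exists_annihilator[of _ _ u]) blast
  have prod0: "(\<Sum>n<m. numerator p x (Suc n) * denominator p q y (Suc n) / (\<beta> n)\<^sup>2 * v n) = 0" for x y
  proof (rule annihilates_product)
    fix i assume "i \<le> p + q"
    then show "(\<Sum>n<m. of_nat (Suc n) ^ i / (\<beta> n)\<^sup>2 * v n) = 0"
      using uv[of i] I(2) by (simp add: u_def k_def)
  qed
  have s_pos: "(\<Sum>n<m. a (e y) n / b (e y) n * v n) = 0" if "1 \<le> y" "y < k" for y
    using uv[of "p + q + y"] that by (simp add: u_def)
  have k0: "0 < k" using I(2) by (simp add: k_def)
  have s_zero: "(\<Sum>n<m. a r n / b r n * v n) = 0" if "r \<in> I" for r
  proof -
    have rest: "(\<Sum>n<m. a r n / b r n * v n) = 0" if "r \<in> I - {e 0}" for r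
    proof -
      have "r \<in> e ` {..<k}" using that e by (auto simp: bij_betw_def)
      then obtain y where "y < k" "r = e y" by blast
      moreover have "y \<noteq> 0" using that \<open>r = e y\<close> by (metis Diff_iff singletonI)
      ultimately show ?thesis using s_pos[of y] by simp
    qed
    have "(\<Sum>n<m. \<alpha> n / \<beta> n * v n) = (\<Sum>n<m. \<alpha> n * \<beta> n / (\<beta> n)\<^sup>2 * v n)"
      using \<beta>0 by (intro sum.cong refl) (simp add: power2_eq_square)
    also have "\<dots> = 0" unfolding \<alpha>_def using prod0[of \<eta> \<eta>] by (simp add: \<beta>_def)
    finally have "0 = (\<Sum>n<m. (\<Sum>r\<in>I. c r * (a r n / b r n)) * v n)" using eq' by simp
    also have "\<dots> = (\<Sum>r\<in>I. c r * (\<Sum>n<m. a r n / b r n * v n))"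
      unfolding sum_distrib_right sum_distrib_left by (subst sum.swap) (simp add: mult_ac)
    also have "\<dots> = c (e 0) * (\<Sum>n<m. a (e 0) n / b (e 0) n * v n)"
      using finI eI[OF k0] rest by (subst sum.remove[of _ "e 0"]) auto
    finally have "(\<Sum>n<m. a (e 0) n / b (e 0) n * v n) = 0" using c[OF eI[OF k0]] by simp
    then show ?thesis using rest that by (cases "r = e 0") auto
  qed
  \<comment> \<open>Apply \<open>D\<close> to the relation: the terms with \<open>D (c s)\<close>
    are killed by \<open>s_zero\<close>, those from \<open>\<eta>\<close> by \<open>prod0\<close>,
    and every source except \<open>r\<close> is constant.\<close>
  have D_zero: "(\<Sum>n<m. D (a r n / b r n) * v n) = 0"
    if D: "is_derivation D" and r: "r \<in> I" and i: "i < p + q + 2" and D1: "D (\<zeta> (r, i)) = 1"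
      and D0: "\<And>y. y \<in> params p q R \<Longrightarrow> y \<noteq> (r, i) \<Longrightarrow> D (\<zeta> y) = 0" for D r i
  proof -
    have const: "D (a s n / b s n) = 0" if "s \<in> I" "s \<noteq> r" for s n
    proof -
      have "D (\<zeta> (s, j)) = 0" if "j < p + q + 2" for j
        using that \<open>s \<in> I\<close> \<open>s \<noteq> r\<close> I(1) by (intro D0) (auto simp: params_def)
      then have "D (a s n) = 0" "D (b s n) = 0"
        unfolding a_def b_def derivation_numerator[OF D] derivation_denominator[OF D]
        by (auto simp: numerator_def denominator_def)
      then show ?thesis using derivation_divide[OF D b0[OF that(1)]] by simp
    qed
    have "(\<Sum>n<m. D (\<alpha> n / \<beta> n) * v n) =
        (\<Sum>n<m. numerator p (\<lambda>i. D (\<eta> i)) (Suc n) * \<beta> n / (\<beta> n)\<^sup>2 * v n) -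
        (\<Sum>n<m. \<alpha> n * denominator p q (\<lambda>i. D (\<eta> i)) (Suc n) / (\<beta> n)\<^sup>2 * v n)"
      unfolding sum_subtractf[symmetric]
    proof (intro sum.cong refl)
      fix n assume "n \<in> {..<m}"
      then have "D (\<alpha> n / \<beta> n) = (D (\<alpha> n) * \<beta> n - \<alpha> n * D (\<beta> n)) / (\<beta> n)\<^sup>2"
        using derivation_divide[OF D \<beta>0] by simp
      moreover have "D (\<alpha> n) = numerator p (\<lambda>i. D (\<eta> i)) (Suc n)"
        "D (\<beta> n) = denominator p q (\<lambda>i. D (\<eta> i)) (Suc n)"
        unfolding \<alpha>_def \<beta>_def derivation_numerator[OF D] derivation_denominator[OF D] by simp_all
      ultimately show "D (\<alpha> n / \<beta> n) * v n =
          numerator p (\<lambda>i. D (\<eta> i)) (Suc n) * \<beta> n / (\<beta> n)\<^sup>2 * v n -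
          \<alpha> n * denominator p q (\<lambda>i. D (\<eta> i)) (Suc n) / (\<beta> n)\<^sup>2 * v n"
        by (simp add: diff_divide_distrib left_diff_distrib)
    qed
    also have "\<dots> = 0"
      using prod0[of "\<lambda>i. D (\<eta> i)" \<eta>] prod0[of \<eta> "\<lambda>i. D (\<eta> i)"] by (simp add: \<alpha>_def \<beta>_def)
    finally have "0 = (\<Sum>n<m. D (\<alpha> n / \<beta> n) * v n)" by simp
    also have "\<dots> = (\<Sum>n<m. (\<Sum>s\<in>I. D (c s) * (a s n / b s n) + c s * D (a s n / b s n)) * v n)"
    proof (intro sum.cong refl)
      fix n assume "n \<in> {..<m}"
      then have n: "n < m" by simp
      show "D (\<alpha> n / \<beta> n) * v n = (\<Sum>s\<in>I. D (c s) * (a s n / b s n) + c s * D (a s n / b s n)) * v n"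
        unfolding eq'[OF n, symmetric] derivation_sum[OF D] derivation_mult[OF D] ..
    qed
    also have "\<dots> = (\<Sum>s\<in>I. D (c s) * (\<Sum>n<m. a s n / b s n * v n) + c s * (\<Sum>n<m. D (a s n / b s n) * v n))"
      unfolding sum_distrib_right sum_distrib_left sum.distrib[symmetric]
      by (subst sum.swap) (simp add: algebra_simps)
    also have "\<dots> = (\<Sum>s\<in>I. c s * (\<Sum>n<m. D (a s n / b s n) * v n))"
      using s_zero by simp
    also have "\<dots> = c r * (\<Sum>n<m. D (a r n / b r n) * v n)"
      using finI r const by (subst sum.remove[of _ r]) auto
    finally show ?thesis using c[OF r] by simp
  qed
  have num_dir: "(\<Sum>n<m. of_nat (Suc n) ^ i / b r n * v n) = 0" if "r \<in> I" "i \<le> p" for r i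
  proof -
    have "(r, i) \<in> params p q R" using that I(1) by (auto simp: params_def)
    then obtain D where D: "is_derivation D" "D (\<zeta> (r, i)) = 1"
      "\<And>y. y \<in> params p q R \<Longrightarrow> y \<noteq> (r, i) \<Longrightarrow> D (\<zeta> y) = 0"
      using generic_point_derivation[OF gen] by blast
    have D\<zeta>: "D (\<zeta> (r, j)) = (if j = i then 1 else 0)" if "j < p + q + 2" for j
      using D(2) D(3)[of "(r, j)"] that \<open>r \<in> I\<close> I(1) by (auto simp: params_def)
    have "D (a r n / b r n) = of_nat (Suc n) ^ i / b r n" for n
    proof -
      have "D (a r n) = (\<Sum>j\<le>p. (if j = i then 1 else 0) * of_nat (Suc n) ^ j)"
        unfolding a_def derivation_numerator[OF D(1)] unfolding numerator_def
        by (intro sum.cong refl) (simp add: D\<zeta> del: of_nat_Suc)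
      also have "\<dots> = of_nat (Suc n) ^ i"
        using that by (subst sum.remove[of _ i]) (auto intro!: sum.neutral)
      finally have "D (a r n) = of_nat (Suc n) ^ i" .
      moreover have "D (b r n) = 0"
        unfolding b_def derivation_denominator[OF D(1)] unfolding denominator_def
        using that by (intro sum.neutral) (simp add: D\<zeta>)
      ultimately show ?thesis
        using derivation_divide[OF D(1) b0[OF that(1)]] b0[OF that(1)] by (simp add: power2_eq_square)
    qed
    then show ?thesis using D_zero[OF D(1) that(1) _ D(2,3)] that by (simp del: of_nat_Suc)
  qed
  have den_dir: "(\<Sum>n<m. of_nat (Suc n) ^ j * a r n / (b r n)\<^sup>2 * v n) = 0" if "r \<in> I" "j \<le> q" for r j
  proof -
    have "(r, p + 1 + j) \<in> params p q R" using that I(1) by (auto simp: params_def)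
    then obtain D where D: "is_derivation D" "D (\<zeta> (r, p + 1 + j)) = 1"
      "\<And>y. y \<in> params p q R \<Longrightarrow> y \<noteq> (r, p + 1 + j) \<Longrightarrow> D (\<zeta> y) = 0"
      using generic_point_derivation[OF gen] by blast
    have D\<zeta>: "D (\<zeta> (r, i)) = (if i = p + 1 + j then 1 else 0)" if "i < p + q + 2" for i
      using D(2) D(3)[of "(r, i)"] that \<open>r \<in> I\<close> I(1) by (auto simp: params_def)
    have "D (a r n / b r n) = - (of_nat (Suc n) ^ j * a r n / (b r n)\<^sup>2)" for n
    proof -
      have "D (b r n) = (\<Sum>i\<le>q. (if i = j then 1 else 0) * of_nat (Suc n) ^ i)"
        unfolding b_def derivation_denominator[OF D(1)] unfolding denominator_def
        by (intro sum.cong refl) (simp add: D\<zeta> del: of_nat_Suc)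
      also have "\<dots> = of_nat (Suc n) ^ j"
        using that by (subst sum.remove[of _ j]) (auto intro!: sum.neutral)
      finally have "D (b r n) = of_nat (Suc n) ^ j" .
      moreover have "D (a r n) = 0"
        unfolding a_def derivation_numerator[OF D(1)] unfolding numerator_def
        using that by (intro sum.neutral) (simp add: D\<zeta>)
      ultimately show ?thesis
        using derivation_divide[OF D(1) b0[OF that(1)]] by (simp add: mult_ac)
    qed
    then show ?thesis using D_zero[OF D(1) that(1) _ D(2,3)] that by (simp add: sum_negf del: of_nat_Suc)
  qed
  let ?A = "\<lambda>y n. numerator p (\<lambda>i. \<zeta> (e y, i)) n"
  let ?B = "\<lambda>y n. denominator p q (\<lambda>i. \<zeta> (e y, i)) n"
  \<comment> \<open>Undoes the multiplication by the product of all squared denominators in the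
    tangent matrix.\<close>
  define w where "w = (\<lambda>n. v n / (\<Prod>y<k. (b (e y) n)\<^sup>2))"
  have prod_nz: "(\<Prod>y<k. (b (e y) n)\<^sup>2) \<noteq> 0" for n using b0 eI by auto
  have cof: "cofactor k ?B y (Suc n) * w n = v n / (b (e y) n)\<^sup>2" if "y < k" for y n
  proof -
    have "(\<Prod>y<k. (b (e y) n)\<^sup>2) = (b (e y) n)\<^sup>2 * cofactor k ?B y (Suc n)"
      using that unfolding cofactor_def b_def by (subst prod.remove[of _ y]) auto
    then show ?thesis using prod_nz[of n] by (auto simp: w_def)
  qed
  have "(\<Sum>n<m. tangent_entry p q k ?A ?B x (Suc n) * w n) = 0" if "x < m" for x
  proof -
    have ab: "?A y (Suc n) = a (e y) n" "?B y (Suc n) = b (e y) n" for y n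
      by (simp_all add: a_def b_def)
    have k2: "2 \<le> k" using I(2) by (simp add: k_def)
    have bdir: "b r n * (v n / (b r n)\<^sup>2) = 1 / b r n * v n" if "r \<in> I" for r n
      using b0[OF that] by (simp add: power2_eq_square)
    consider "x \<le> p" | "p < x" "x \<le> p + q" | "x = p + q + 1" | "p + q + 1 < x" by linarith
    then show ?thesis
    proof cases
      case 1
      then have "tangent_entry p q k ?A ?B x (Suc n) * w n = of_nat (Suc n) ^ x / b (e 0) n * v n" for n
        using bdir[OF eI[OF k0], of n]
        by (simp add: tangent_entry_def ab cof[OF k0] mult.assoc del: of_nat_Suc)
      then show ?thesis using num_dir[OF eI[OF k0] 1] by simp
    next
      case 2
      then have "tangent_entry p q k ?A ?B x (Suc n) * w n =
          of_nat (Suc n) ^ (x - p) * a (e 0) n / (b (e 0) n)\<^sup>2 * v n" for n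
        by (simp add: tangent_entry_def ab cof[OF k0] mult.assoc del: of_nat_Suc)
      then show ?thesis using den_dir[OF eI[OF k0], of "x - p"] 2 by simp
    next
      case 3
      then have "tangent_entry p q k ?A ?B x (Suc n) * w n = of_nat (Suc n) ^ 0 / b (e 1) n * v n" for n
        using bdir[OF eI, of 1 n] k2 cof[of 1 n]
        by (simp add: tangent_entry_def ab mult.assoc del: of_nat_Suc)
      then show ?thesis using num_dir[OF eI, of 1 0] k2 by simp
    next
      case 4
      define y where "y = x - (p + q + 1)"
      have x: "x = p + q + 1 + y" using 4 by (simp add: y_def)
      have y: "y < k" using 4 that by (simp add: y_def m k_def)
      have "tangent_entry p q k ?A ?B x (Suc n) * w n =
          of_nat (Suc n) ^ 0 * a (e y) n / (b (e y) n)\<^sup>2 * v n" for n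
        using 4 cof[OF y, of n]
        by (simp add: tangent_entry_def ab mult.assoc x del: of_nat_Suc)
      then show ?thesis using den_dir[OF eI[OF y], of 0] by simp
    qed
  qed
  moreover have "\<exists>n<m. w n \<noteq> 0" using v prod_nz by (auto simp: w_def)
  ultimately have "det (mat m m (\<lambda>(x, n). tangent_entry p q k ?A ?B x (Suc n))) = 0"
    unfolding det_mat_eq_0_iff by blast
  moreover have "inj_on e {..<k}" "e ` {..<k} \<subseteq> {..<R}" "2 \<le> k"
    using e I by (auto simp: bij_betw_def k_def)
  ultimately show False
    using generic_tangent_det_nonzero[OF gen _ _ _ q, of e k] by (simp add: m k_def)
qed

subsection \<open>Uniqueness of the factorization\<close>

text \<open>Induction on the columns: a functional that kills the old columns and is 1 on the new
  one supplies the new row of \<open>L\<close> and corrects the old rows.\<close>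

lemma left_inverse_exists:
  fixes M :: "nat \<Rightarrow> nat \<Rightarrow> 'a::field"
  assumes "\<And>x. (\<And>i. i < K \<Longrightarrow> (\<Sum>r<R. M i r * x r) = 0) \<Longrightarrow> \<forall>r<R. x r = 0"
  shows "\<exists>L. \<forall>r<R. \<forall>t<R. (\<Sum>i<K. L r i * M i t) = (if r = t then 1 else 0)"
  using assms
proof (induction R)
  case 0 then show ?case by simp
next
  case (Suc R)
  have "\<forall>r<R. x r = 0" if "\<And>i. i < K \<Longrightarrow> (\<Sum>r<R. M i r * x r) = 0" for x
  proof -
    have "\<forall>r<Suc R. (x(R := 0)) r = 0"
      by (rule Suc.prems) (use that in simp)
    then show ?thesis by (metis fun_upd_other less_SucI less_irrefl)
  qed
  from Suc.IH[OF this] obtain L where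
    L: "\<And>r t. r < R \<Longrightarrow> t < R \<Longrightarrow> (\<Sum>i<K. L r i * M i t) = (if r = t then 1 else 0)" by blast
  define d where "d = (\<lambda>t. \<Sum>i<K. L t i * M i R)"
  \<comment> \<open>The part of the new column not reproduced by the old ones. If it were zero,
    \<open>- d\<close> extended by 1 would be a nontrivial kernel vector.\<close>
  define w where "w = (\<lambda>i. M i R - (\<Sum>t<R. M i t * d t))"
  have "\<exists>i<K. w i \<noteq> 0"
  proof (rule ccontr)
    assume *: "\<not> (\<exists>i<K. w i \<noteq> 0)"
    have "\<forall>r<Suc R. (\<lambda>t. if t = R then 1 else - d t) r = 0"
      by (rule Suc.prems) (use * in \<open>auto simp: w_def sum_negf\<close>)
    then show False by auto
  qed
  then obtain i0 where i0: "i0 < K" "w i0 \<noteq> 0" by blast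
  \<comment> \<open>Coordinate \<open>i0\<close> of the residual map that sends the new column to
    \<open>w\<close> and the old columns to 0, normalised by \<open>w i0\<close>.\<close>
  define l where "l = (\<lambda>i. ((if i = i0 then 1 else 0) - (\<Sum>t<R. M i0 t * L t i)) / w i0)"
  have l: "(\<Sum>i<K. l i * M i s) = (M i0 s - (\<Sum>t<R. M i0 t * (\<Sum>i<K. L t i * M i s))) / w i0" for s
  proof -
    have "(\<Sum>i<K. l i * M i s) =
        ((\<Sum>i<K. (if i = i0 then 1 else 0) * M i s) - (\<Sum>i<K. \<Sum>t<R. M i0 t * L t i * M i s)) / w i0"
      unfolding l_def sum_subtractf[symmetric] sum_divide_distrib
      by (intro sum.cong refl) (simp add: left_diff_distrib sum_distrib_right)
    also have "(\<Sum>i<K. (if i = i0 then 1 else 0) * M i s) = M i0 s"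
      using i0(1) by (simp add: if_distrib[of "\<lambda>x. x * _"] sum.delta cong: if_cong)
    also have "(\<Sum>i<K. \<Sum>t<R. M i0 t * L t i * M i s) = (\<Sum>t<R. M i0 t * (\<Sum>i<K. L t i * M i s))"
      unfolding sum_distrib_left by (subst sum.swap) (simp add: mult_ac)
    finally show ?thesis .
  qed
  have l_old: "(\<Sum>i<K. l i * M i s) = 0" if "s < R" for s
  proof -
    have "(\<Sum>t<R. M i0 t * (\<Sum>i<K. L t i * M i s)) = M i0 s"
      using that by (simp add: L if_distrib[of "\<lambda>x. _ * x"] sum.delta cong: if_cong)
    then show ?thesis by (simp add: l)
  qed
  have l_new: "(\<Sum>i<K. l i * M i R) = 1"
    using i0(2) unfolding l w_def d_def by simp
  define L' where "L' = (\<lambda>r i. if r = R then l i else L r i - d r * l i)"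
  have split: "(\<Sum>i<K. L' r i * M i t) = (\<Sum>i<K. L r i * M i t) - d r * (\<Sum>i<K. l i * M i t)"
    if "r < R" for r t
    using that by (simp add: L'_def sum_subtractf sum_distrib_left algebra_simps)
  have "(\<Sum>i<K. L' r i * M i t) = (if r = t then 1 else 0)" if "r < Suc R" "t < Suc R" for r t
  proof (cases "r = R")
    case True
    then show ?thesis using that l_old[of t] l_new by (auto simp: L'_def less_Suc_eq)
  next
    case False
    then have "r < R" using that by simp
    show ?thesis
    proof (cases "t = R")
      case True
      then show ?thesis using split[OF \<open>r < R\<close>, of R] l_new False by (simp add: d_def)
    next
      case False
      then show ?thesis using split[OF \<open>r < R\<close>, of t] l_old[of t] L[OF \<open>r < R\<close>, of t] that by simp
    qed
  qed
  then show ?case by blast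
qed

lemma right_inverse_imp_left_inverse:
  fixes T U :: "nat \<Rightarrow> nat \<Rightarrow> 'a::field"
  assumes "\<And>r t. r < R \<Longrightarrow> t < R \<Longrightarrow> (\<Sum>j<R. T r j * U j t) = (if r = t then 1 else 0)"
    and "i < R" "j < R"
  shows "(\<Sum>r<R. U i r * T r j) = (if i = j then 1 else 0)"
proof -
  let ?T = "mat R R (\<lambda>(r, j). T r j)" and ?U = "mat R R (\<lambda>(r, j). U r j)"
  have "?T * ?U = 1\<^sub>m R"
    using assms(1) by (intro eq_matI) (auto simp: scalar_prod_def lessThan_atLeast0)
  then have "?U * ?T = 1\<^sub>m R" by (rule mat_mult_left_right_inverse[of ?T R ?U, rotated 2]) simp_all
  then have "(?U * ?T) $$ (i, j) = (if i = j then 1 else 0)" using assms(2,3) by simp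
  then show ?thesis using assms(2,3) by (simp add: scalar_prod_def lessThan_atLeast0)
qed

text \<open>A left inverse of \<open>M\<close> expresses \<open>s\<close> through \<open>s'\<close>
  by a square matrix \<open>T\<close>. Independence makes \<open>T\<close> invertible, so each
  \<open>s' j\<close> is a combination of the \<open>s r\<close>, and \<open>rigid\<close> leaves
  one term of it.\<close>

lemma factorization_unique:
  fixes M M' s s' :: "nat \<Rightarrow> nat \<Rightarrow> 'a::field"
  assumes M: "\<And>x. (\<And>i. i < K \<Longrightarrow> (\<Sum>r<R. M i r * x r) = 0) \<Longrightarrow> \<forall>r<R. x r = 0"
    and indep: "\<And>c. (\<And>n. n < N \<Longrightarrow> (\<Sum>r<R. c r * s r n) = 0) \<Longrightarrow> \<forall>r<R. c r = 0"
    and rigid: "\<And>c j r r'. j < R \<Longrightarrow> (\<And>n. n < N \<Longrightarrow> (\<Sum>r<R. c r * s r n) = s' j n) \<Longrightarrow>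
      r < R \<Longrightarrow> r' < R \<Longrightarrow> c r \<noteq> 0 \<Longrightarrow> c r' \<noteq> 0 \<Longrightarrow> r = r'"
    and eq: "\<And>i n. i < K \<Longrightarrow> n < N \<Longrightarrow> (\<Sum>r<R. M i r * s r n) = (\<Sum>r<R. M' i r * s' r n)"
  shows "\<exists>\<sigma>. \<sigma> permutes {..<R} \<and>
    (\<forall>r<R. \<forall>i<K. \<forall>n<N. M' i r * s' r n = M i (\<sigma> r) * s (\<sigma> r) n)"
proof -
  obtain L where L: "\<And>r t. r < R \<Longrightarrow> t < R \<Longrightarrow> (\<Sum>i<K. L r i * M i t) = (if r = t then 1 else 0)"
    using left_inverse_exists[where K = K and R = R and M = M] M by blast
  define T where "T = (\<lambda>r j. \<Sum>i<K. L r i * M' i j)"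
  have sT: "s r n = (\<Sum>j<R. T r j * s' j n)" if "r < R" "n < N" for r n
  proof -
    have "s r n = (\<Sum>t<R. (\<Sum>i<K. L r i * M i t) * s t n)"
      using that by (simp add: L if_distrib[of "\<lambda>x. x * _"] sum.delta' cong: if_cong)
    also have "\<dots> = (\<Sum>i<K. L r i * (\<Sum>t<R. M i t * s t n))"
      unfolding sum_distrib_left sum_distrib_right by (subst sum.swap) (simp add: mult_ac)
    also have "\<dots> = (\<Sum>i<K. L r i * (\<Sum>t<R. M' i t * s' t n))" using eq that by simp
    also have "\<dots> = (\<Sum>j<R. T r j * s' j n)"
      unfolding T_def sum_distrib_left sum_distrib_right by (subst sum.swap) (simp add: mult_ac)
    finally show ?thesis .
  qed
  have "\<forall>r<R. x r = 0" if x: "\<And>j. j < R \<Longrightarrow> (\<Sum>r<R. T r j * x r) = 0" for x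
  proof (rule indep)
    fix n assume "n < N"
    then have "(\<Sum>r<R. x r * s r n) = (\<Sum>r<R. \<Sum>j<R. x r * T r j * s' j n)"
      by (simp add: sT sum_distrib_left mult_ac)
    also have "\<dots> = (\<Sum>j<R. (\<Sum>r<R. T r j * x r) * s' j n)"
      unfolding sum_distrib_right by (subst sum.swap) (simp add: mult_ac)
    finally show "(\<Sum>r<R. x r * s r n) = 0" using x by simp
  qed
  then obtain U where U: "\<And>r t. r < R \<Longrightarrow> t < R \<Longrightarrow> (\<Sum>j<R. U r j * T t j) = (if r = t then 1 else 0)"
    using left_inverse_exists[where K = R and R = R and M = "\<lambda>j r. T r j"] by blast
  \<comment> \<open>\<open>U\<close> is a left inverse of the transpose of \<open>T\<close>, so its
    transpose is a right inverse of \<open>T\<close>, hence two-sided.\<close>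
  define V where "V = (\<lambda>j r. U r j)"
  have VT: "(\<Sum>r<R. V i r * T r j) = (if i = j then 1 else 0)" if "i < R" "j < R" for i j
  proof (rule right_inverse_imp_left_inverse[OF _ that])
    fix r t assume "r < R" "t < R"
    then show "(\<Sum>j<R. T r j * V j t) = (if r = t then 1 else 0)"
      using U[of t r] by (auto simp: V_def mult.commute)
  qed
  have s'V: "(\<Sum>r<R. V j r * s r n) = s' j n" if "j < R" "n < N" for j n
  proof -
    have "(\<Sum>r<R. V j r * s r n) = (\<Sum>r<R. \<Sum>i<R. V j r * T r i * s' i n)"
      using that by (simp add: sT sum_distrib_left mult_ac)
    also have "\<dots> = (\<Sum>i<R. (\<Sum>r<R. V j r * T r i) * s' i n)"
      unfolding sum_distrib_right by (rule sum.swap)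
    also have "\<dots> = s' j n"
      using that by (simp add: VT if_distrib[of "\<lambda>x. x * _"] sum.delta' cong: if_cong)
    finally show ?thesis .
  qed
  have "\<exists>r<R. V j r \<noteq> 0" if "j < R" for j
  proof (rule ccontr)
    assume "\<not> (\<exists>r<R. V j r \<noteq> 0)"
    then have "(\<Sum>r<R. V j r * T r j) = 0" by (intro sum.neutral) auto
    then show False using VT[OF that that] by simp
  qed
  then obtain \<tau> where \<tau>: "\<And>j. j < R \<Longrightarrow> \<tau> j < R" "\<And>j. j < R \<Longrightarrow> V j (\<tau> j) \<noteq> 0" by metis
  have V0: "V j r = 0" if "j < R" "r < R" "r \<noteq> \<tau> j" for j r
    using rigid[OF that(1) s'V[OF that(1)] that(2) \<tau>(1)[OF that(1)]] \<tau>(2)[OF that(1)] that(3) by blast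
  have single: "(\<Sum>r<R. V j r * h r) = V j (\<tau> j) * h (\<tau> j)" if "j < R" for j h
    using that V0 \<tau>(1) by (subst sum.remove[of _ "\<tau> j"]) (auto intro!: sum.neutral)
  have s'\<tau>: "s' j n = V j (\<tau> j) * s (\<tau> j) n" if "j < R" "n < N" for j n
    using s'V[OF that] single[OF that(1)] by simp
  \<comment> \<open>Rows of \<open>V\<close> supported at the same index would be proportional,
    which invertibility excludes.\<close>
  have inj: "inj_on \<tau> {..<R}"
  proof (rule inj_onI, rule ccontr)
    fix i j assume ij: "i \<in> {..<R}" "j \<in> {..<R}" "\<tau> i = \<tau> j" "i \<noteq> j"
    then have "V i (\<tau> i) * T (\<tau> i) j = 0" "V j (\<tau> j) * T (\<tau> j) j = 1"
      using VT[of i j] VT[of j j] by (simp_all add: single)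
    then show False using ij \<tau>(2)[of i] by auto
  qed
  have bij: "bij_betw \<tau> {..<R} {..<R}"
    unfolding bij_betw_def using inj \<tau>(1) endo_inj_surj[of "{..<R}" \<tau>] by auto
  define \<sigma> where "\<sigma> = (\<lambda>j. if j < R then \<tau> j else j)"
  have "bij_betw \<sigma> {..<R} {..<R}" using bij by (subst bij_betw_cong[of _ _ \<tau>]) (auto simp: \<sigma>_def)
  then have perm: "\<sigma> permutes {..<R}" by (rule bij_imp_permutes) (auto simp: \<sigma>_def)
  \<comment> \<open>Comparing coefficients of the independent \<open>s r\<close> in both
    factorizations.\<close>
  have coeff: "M' i j * V j (\<tau> j) = M i (\<tau> j)" if "i < K" "j < R" for i j
  proof -
    define c where "c = (\<lambda>r. M' i (inv_into {..<R} \<tau> r) * V (inv_into {..<R} \<tau> r) r)"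
    have c: "c (\<tau> j) = M' i j * V j (\<tau> j)" if "j < R" for j
      using that inj by (simp add: c_def)
    have "\<forall>r<R. M i r - c r = 0"
    proof (rule indep)
      fix n assume "n < N"
      have "(\<Sum>r<R. M i r * s r n) = (\<Sum>j<R. c (\<tau> j) * s (\<tau> j) n)"
        using eq[OF \<open>i < K\<close> \<open>n < N\<close>] \<open>n < N\<close> by (simp add: s'\<tau> c mult_ac)
      also have "\<dots> = (\<Sum>r<R. c r * s r n)" by (rule sum.reindex_bij_betw[OF bij])
      finally show "(\<Sum>r<R. (M i r - c r) * s r n) = 0"
        by (simp add: left_diff_distrib sum_subtractf)
    qed
    then show ?thesis using c[OF that(2)] \<tau>(1)[OF that(2)] by simp
  qed
  have "M' i r * s' r n = M i (\<sigma> r) * s (\<sigma> r) n" if "r < R" "i < K" "n < N" for r i n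
    using that coeff[of i r] s'\<tau>[of r n] by (simp add: \<sigma>_def mult.assoc[symmetric])
  then show ?thesis using perm by blast
qed

lemma full_column_rank_injective:
  fixes M :: "'a::field mat"
  assumes M: "M \<in> carrier_mat K R" and rank: "vec_space.rank K M = R"
    and zero: "\<And>i. i < K \<Longrightarrow> (\<Sum>r<R. M $$ (i, r) * x r) = 0"
  shows "\<forall>r<R. x r = 0"
proof -
  interpret vec_space "TYPE('a)" K .
  \<comment> \<open>Linear independence is stated for the set of columns, so repetitions must be
    excluded first: they would bound the rank by fewer than \<open>R\<close> vectors.\<close>
  have "distinct (cols M)"
  proof (rule ccontr)
    assume "\<not> distinct (cols M)"
    then have "card (set (cols M)) < R"
      using M by (metis card_distinct card_length carrier_matD(2) cols_length le_neq_implies_less)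
    moreover obtain S where S: "maximal S (\<lambda>T. T \<subseteq> set (cols M) \<and> lin_indpt T)"
      using maximal_exists_superset[of "set (cols M)" "\<lambda>T. T \<subseteq> set (cols M) \<and> lin_indpt T" "{}"]
      by (auto simp: finite_lin_indpt2)
    moreover have "card S \<le> card (set (cols M))"
      using S by (auto simp: maximal_def intro: card_mono)
    ultimately show False using rank_card_indpt[OF M S] rank by simp
  qed
  then have indpt: "\<not> lin_dep (set (cols M))" using full_rank_lin_indpt[OF M] rank by blast
  have "M *\<^sub>v vec R x = 0\<^sub>v K"
    using M zero by (intro eq_vecI) (auto simp: scalar_prod_def lessThan_atLeast0)
  then have "vec R x = 0\<^sub>v R"
    using lin_depI[OF M _ _ _ \<open>distinct (cols M)\<close>, of "vec R x"] indpt by auto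
  then show ?thesis by (auto simp: vec_eq_iff)
qed

section \<open>Rigidity, independence and recovery for generic sources\<close>

text \<open>Restrict the combination to its support \<open>I\<close>. As
  \<open>card I \<le> R\<close>, the \<open>N\<close> samples include the
  \<open>card I + p + q + 1\<close> that exclude a support of two or more sources.\<close>

lemma generic_combination_single:
  fixes \<zeta> :: "nat \<times> nat \<Rightarrow> 'a::field_char_0"
  assumes gen: "generic_point (params p q R) \<zeta>" and q: "1 \<le> q" and N: "R + (p + q + 1) \<le> N"
    and \<eta>: "admissible p q N \<eta>"
    and eq: "\<And>n. n < N \<Longrightarrow>
      (\<Sum>r<R. c r * (numerator p (\<lambda>i. \<zeta> (r, i)) (Suc n) / denominator p q (\<lambda>i. \<zeta> (r, i)) (Suc n))) =
      numerator p \<eta> (Suc n) / denominator p q \<eta> (Suc n)"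
    and rr: "r < R" "r' < R" "c r \<noteq> 0" "c r' \<noteq> 0"
  shows "r = r'"
proof (rule ccontr)
  assume "r \<noteq> r'"
  define I where "I = {t. t < R \<and> c t \<noteq> 0}"
  have I: "I \<subseteq> {..<R}" "finite I" by (auto simp: I_def)
  have "{r, r'} \<subseteq> I" using rr by (auto simp: I_def)
  then have "card {r, r'} \<le> card I" using I(2) by (rule card_mono[rotated])
  then have "2 \<le> card I" using \<open>r \<noteq> r'\<close> by simp
  have "card I \<le> R" using card_mono[OF _ I(1)] by simp
  show False
  proof (rule generic_combination_not_rational[OF gen I(1) \<open>2 \<le> card I\<close> q refl])
    show "admissible p q (card I + p + q + 1) \<eta>"
      using \<eta> N \<open>card I \<le> R\<close> by (auto simp: admissible_def)
    fix n assume "n < card I + p + q + 1"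
    then have "n < N" using N \<open>card I \<le> R\<close> by linarith
    have "(\<Sum>r\<in>I. c r * (numerator p (\<lambda>i. \<zeta> (r, i)) (Suc n) / denominator p q (\<lambda>i. \<zeta> (r, i)) (Suc n))) =
        (\<Sum>r<R. c r * (numerator p (\<lambda>i. \<zeta> (r, i)) (Suc n) / denominator p q (\<lambda>i. \<zeta> (r, i)) (Suc n)))"
      by (rule sum.mono_neutral_left) (auto simp: I_def)
    then show "(\<Sum>r\<in>I. c r * (numerator p (\<lambda>i. \<zeta> (r, i)) (Suc n) / denominator p q (\<lambda>i. \<zeta> (r, i)) (Suc n))) =
        numerator p \<eta> (Suc n) / denominator p q \<eta> (Suc n)"
      using eq[OF \<open>n < N\<close>] by simp
  qed (auto simp: I_def)
qed

lemma generic_sources_independent: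
  fixes \<zeta> :: "nat \<times> nat \<Rightarrow> 'a::field_char_0"
  assumes gen: "generic_point (params p q R) \<zeta>" and q: "1 \<le> q" and N: "R + (p + q + 1) \<le> N"
    and eq: "\<And>n. n < N \<Longrightarrow>
      (\<Sum>r<R. c r * (numerator p (\<lambda>i. \<zeta> (r, i)) (Suc n) / denominator p q (\<lambda>i. \<zeta> (r, i)) (Suc n))) = 0"
  shows "\<forall>r<R. c r = 0"
proof (intro allI impI, rule ccontr)
  fix r assume r: "r < R" "c r \<noteq> 0"
  \<comment> \<open>The zero vector is an admissible source, 0 divided by 1, so rigidity leaves at
    most one nonzero coefficient. A generic source does not vanish at the first sample, which
    excludes that one too.\<close>
  define \<eta> :: "nat \<Rightarrow> 'a" where "\<eta> = (\<lambda>i. if i = p + 1 then 1 else 0)"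
  have num: "numerator p \<eta> n = 0" for n by (auto simp: numerator_def \<eta>_def)
  have den: "denominator p q \<eta> n = 1" for n
    unfolding denominator_def by (subst sum.remove[of _ 0]) (auto simp: \<eta>_def intro!: sum.neutral)
  have other: "c t = 0" if "t < R" "t \<noteq> r" for t
    using generic_combination_single[OF gen q N, of \<eta> c t r] eq r that
    by (auto simp: admissible_def num den)
  let ?s = "numerator p (\<lambda>i. \<zeta> (r, i)) (Suc 0) / denominator p q (\<lambda>i. \<zeta> (r, i)) (Suc 0)"
  have "(\<Sum>t<R. c t * (numerator p (\<lambda>i. \<zeta> (t, i)) (Suc 0) / denominator p q (\<lambda>i. \<zeta> (t, i)) (Suc 0))) = c r * ?s"
    using r other by (subst sum.remove[of _ r]) (auto intro!: sum.neutral)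
  then have "c r * ?s = 0" using eq[of 0] N by simp
  then show False
    using r generic_numerator_nonzero[OF gen r(1)] generic_denominator_nonzero[OF gen r(1)] by simp
qed

lemma source_mat_index:
  "r < R \<Longrightarrow> n < N \<Longrightarrow> source_mat p q N R \<zeta> $$ (n, r) =
    numerator p (\<lambda>i. \<zeta> (r, i)) (Suc n) / denominator p q (\<lambda>i. \<zeta> (r, i)) (Suc n)"
  by (simp add: source_mat_def source_vec_def mat_of_cols_index)

lemma source_mat_carrier: "source_mat p q N R \<zeta> \<in> carrier_mat N R"
  by (simp add: source_mat_def carrier_matI)

lemma generic_uniquely_recovered:
  fixes \<zeta> :: "nat \<times> nat \<Rightarrow> 'a::field_char_0"
  assumes gen: "generic_point (params p q R) \<zeta>" and q: "1 \<le> q" and N: "R + (p + q + 1) \<le> N"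
    and M: "M \<in> carrier_mat K R" "vec_space.rank K M = R"
  shows "uniquely_recovered p q K N R M (source_mat p q N R \<zeta>)"
  unfolding uniquely_recovered_def
proof (intro ballI impI)
  let ?S = "source_mat p q N R \<zeta>"
  fix M' S' assume M': "M' \<in> carrier_mat K R" and S': "S' \<in> carrier_mat N R"
    and adm: "\<forall>r<R. \<exists>\<eta>. admissible p q N \<eta> \<and> col S' r = source_vec p q N \<eta>"
    and eq: "M * ?S\<^sup>T = M' * S'\<^sup>T"
  note carriers = M(1) M' S' source_mat_carrier[of p q N R \<zeta>]
  have prod: "(A * B\<^sup>T) $$ (i, n) = (\<Sum>r<R. A $$ (i, r) * B $$ (n, r))"
    if "A \<in> carrier_mat K R" "B \<in> carrier_mat N R" "i < K" "n < N" for A B :: "'a mat" and i n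
    using that by (auto simp: scalar_prod_def lessThan_atLeast0)
  have "\<exists>\<sigma>. \<sigma> permutes {..<R} \<and> (\<forall>r<R. \<forall>i<K. \<forall>n<N.
      M' $$ (i, r) * S' $$ (n, r) = M $$ (i, \<sigma> r) * ?S $$ (n, \<sigma> r))"
  proof (rule factorization_unique[where s = "\<lambda>r n. ?S $$ (n, r)" and s' = "\<lambda>r n. S' $$ (n, r)"
        and M = "\<lambda>i r. M $$ (i, r)" and M' = "\<lambda>i r. M' $$ (i, r)"])
    show "\<forall>r<R. x r = 0" if "\<And>i. i < K \<Longrightarrow> (\<Sum>r<R. M $$ (i, r) * x r) = 0" for x
      using full_column_rank_injective[OF M that] .
    show "\<forall>r<R. c r = 0" if "\<And>n. n < N \<Longrightarrow> (\<Sum>r<R. c r * ?S $$ (n, r)) = 0" for c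
      using that by (intro generic_sources_independent[OF gen q N]) (simp add: source_mat_index)
    show "r = r'" if "j < R" and comb: "\<And>n. n < N \<Longrightarrow> (\<Sum>r<R. c r * ?S $$ (n, r)) = S' $$ (n, j)"
      and "r < R" "r' < R" "c r \<noteq> 0" "c r' \<noteq> 0" for c j r r'
    proof -
      obtain \<eta> where \<eta>: "admissible p q N \<eta>" "col S' j = source_vec p q N \<eta>"
        using adm \<open>j < R\<close> by blast
      have "S' $$ (n, j) = numerator p \<eta> (Suc n) / denominator p q \<eta> (Suc n)" if "n < N" for n
        using arg_cong[OF \<eta>(2), of "\<lambda>v. v $ n"] that S' \<open>j < R\<close> by (simp add: source_vec_def)
      then show ?thesis
        using comb that by (intro generic_combination_single[OF gen q N \<eta>(1), of c])
          (simp_all add: source_mat_index)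
    qed
    show "(\<Sum>r<R. M $$ (i, r) * ?S $$ (n, r)) = (\<Sum>r<R. M' $$ (i, r) * S' $$ (n, r))"
      if "i < K" "n < N" for i n
      using arg_cong[OF eq, of "\<lambda>A. A $$ (i, n)"]
      unfolding prod[OF carriers(1,4) that] prod[OF carriers(2,3) that] .
  qed
  then obtain \<sigma> where \<sigma>: "\<sigma> permutes {..<R}" and entries: "\<And>r i n. r < R \<Longrightarrow> i < K \<Longrightarrow> n < N \<Longrightarrow>
      M' $$ (i, r) * S' $$ (n, r) = M $$ (i, \<sigma> r) * ?S $$ (n, \<sigma> r)" by blast
  have "outer_product (col M' r) (col S' r) = outer_product (col M (\<sigma> r)) (col ?S (\<sigma> r))" if "r < R" for r
  proof -
    have "\<sigma> r < R" using permutes_in_image[OF \<sigma>, of r] that by simp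
    then show ?thesis
      using entries[OF that] carriers that by (intro eq_matI) (auto simp: outer_product_def)
  qed
  then show "\<exists>\<sigma>. \<sigma> permutes {..<R} \<and>
      (\<forall>r<R. outer_product (col M' r) (col S' r) = outer_product (col M (\<sigma> r)) (col ?S (\<sigma> r)))"
    using \<sigma> by blast
qed

text \<open>Generic points form a set of full measure chosen independently of \<open>M\<close>. The
  type class covers the real and the complex numbers at once.\<close>

lemma AE_uniquely_recovered:
  fixes M :: "'a::{real_normed_field, euclidean_space} mat"
  assumes "1 \<le> q" "R + (p + q + 1) \<le> N" "M \<in> carrier_mat K R" "vec_space.rank K M = R"
  shows "AE \<zeta> in param_measure p q R.
    (\<forall>r<R. admissible p q N (\<lambda>i. \<zeta> (r, i))) \<and> uniquely_recovered p q K N R M (source_mat p q N R \<zeta>)"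
proof -
  have "AE \<zeta> in param_measure p q R. generic_point (params p q R) (\<zeta> :: _ \<Rightarrow> 'a)"
    unfolding param_measure_def params_def by (rule AE_generic_point) simp
  then show ?thesis
  proof eventually_elim
    case (elim \<zeta>)
    then show ?case
      using generic_denominator_nonzero[OF elim] generic_uniquely_recovered[OF elim assms]
      by (simp add: admissible_def)
  qed
qed

theorem theorem6:
  fixes K N R p q :: nat
  assumes "0 < K" and "0 < N" and "0 < R" and "1 \<le> q"
    and "int R \<le> int N - int (p + q + 1)"
  shows "(\<forall>M :: real mat. M \<in> carrier_mat K R \<and> vec_space.rank K M = R \<longrightarrow>
            (AE \<zeta> in param_measure p q R.
               (\<forall>r<R. admissible p q N (\<lambda>i. \<zeta> (r, i))) \<and>
               uniquely_recovered p q K N R M (source_mat p q N R \<zeta>)))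
       \<and> (\<forall>M :: complex mat. M \<in> carrier_mat K R \<and> vec_space.rank K M = R \<longrightarrow>
            (AE \<zeta> in param_measure p q R.
               (\<forall>r<R. admissible p q N (\<lambda>i. \<zeta> (r, i))) \<and>
               uniquely_recovered p q K N R M (source_mat p q N R \<zeta>)))"
proof -
  have N: "R + (p + q + 1) \<le> N" using assms(5) by linarith
  show ?thesis
  proof (intro conjI allI impI)
    fix M :: "real mat" assume "M \<in> carrier_mat K R \<and> vec_space.rank K M = R"
    then show "AE \<zeta> in param_measure p q R. (\<forall>r<R. admissible p q N (\<lambda>i. \<zeta> (r, i))) \<and>
        uniquely_recovered p q K N R M (source_mat p q N R \<zeta>)"
      using AE_uniquely_recovered[OF assms(4) N] by blast
  next
    fix M :: "complex mat" assume "M \<in> carrier_mat K R \<and> vec_space.rank K M = R"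
    then show "AE \<zeta> in param_measure p q R. (\<forall>r<R. admissible p q N (\<lambda>i. \<zeta> (r, i))) \<and>
        uniquely_recovered p q K N R M (source_mat p q N R \<zeta>)"
      using AE_uniquely_recovered[OF assms(4) N] by blast
  qed
qed

end
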